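(* Let $K$ be a field of characteristic different from two, let $A=K[x_{i,j},y_{i,j}\,(1\le i<j\le 4),\ z_{i,j,k}\,(1\le i<j<k\le 4)]$ and $B=A[t]$. Let $$J=\langle u_{2,3,4},u_{1,3,4},u_{1,2,4},u_{1,2,3},u\rangle\subset A,$$ $$J(t)=\langle u_{2,3,4}-tz_{2,3,4},\ u_{1,3,4}-tz_{1,3,4},\ u_{1,2,4}-tz_{1,2,4},\ u_{1,2,3}+tz_{1,2,3},\ u-t^2\rangle\subset B,$$ with notation as in the context. Then the ideals $J$ (in $A$) and $J(t)$ (in $B$) are in the linkage class of complete intersections.
   Context: Let $\Delta(ij,kl)=x_{i,j}y_{k,l}-x_{k,l}y_{i,j}$, and $\delta_1=\Delta(12,34)$, $\delta_2=\Delta(13,24)$, $\delta_3=\Delta(14,23)$. Put \begin{align*} u_{1,2,3}&=-2z_{2,3,4}\Delta(12,13)+2z_{1,3,4}\Delta(12,23)-2z_{1,2,4}\Delta(13,23)+z_{1,2,3}(\delta_2-\delta_1+\delta_3),\\ u_{1,2,4}&=2z_{2,3,4}\Delta(12,14)-2z_{1,3,4}\Delta(12,24)+z_{1,2,4}(\delta_1+\delta_2+\delta_3)-2z_{1,2,3}\Delta(14,24),\\ u_{1,3,4}&=2z_{2,3,4}\Delta(13,14)+z_{1,3,4}(-\delta_1-\delta_2+\delta_3)+2z_{1,2,4}\Delta(13,34)-2z_{1,2,3}\Delta(14,34),\\ u_{2,3,4}&=z_{2,3,4}(-\delta_1+\delta_2-\delta_3)-2z_{1,3,4}\Delta(23,24)+2z_{1,2,4}\Delta(23,34)-2z_{1,2,3}\Delta(24,34),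 \end{align*} \begin{align*} a&=x_{1,2}x_{3,4}-x_{1,3}x_{2,4}+x_{1,4}x_{2,3},\\ b&=x_{1,2}y_{3,4}-x_{1,3}y_{2,4}+x_{1,4}y_{2,3}+x_{3,4}y_{1,2}-x_{2,4}y_{1,3}+x_{2,3}y_{1,4},\\ c&=y_{1,2}y_{3,4}-y_{1,3}y_{2,4}+y_{1,4}y_{2,3}, \end{align*} and $u=b^2-4ac$. Linkage: two proper ideals $I,I'$ of a ring $R$ (here $R=A$ or $R=B$) are (directly) linked if there is an ideal $L\subseteq I\cap I'$ generated by an $R$-regular sequence with $I'=(L:I)$ and $I=(L:I')$. An ideal $I$ is in the linkage class of a complete intersection if there is a finite chain $I=I_0,I_1,\dots,I_n$ of ideals of $R$ with $I_{k}$ and $I_{k+1}$ directly linked for all $k$ and $I_n$ generated by a regular sequence. *)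

theory Defs
  imports "HOL-Library.Poly_Mapping" "HOL-Computational_Algebra.Computational_Algebra"
begin

text \<open>A commutative ring as a module over itself: its submodules (\<open>ideal.subspace\<close>) are its
  ideals and \<open>ideal.span S\<close> is the ideal generated by \<open>S\<close>.\<close>

global_interpretation ideal: module "times :: 'a::comm_ring_1 \<Rightarrow> 'a \<Rightarrow> 'a"
  by unfold_locales (simp_all add: algebra_simps)

definition colon_ideal :: "'a::comm_ring_1 set \<Rightarrow> 'a set \<Rightarrow> 'a set" where
  "colon_ideal L I = {r. \<forall>a\<in>I. r * a \<in> L}"

text \<open>Each \<open>f\<^sub>i\<close> is a nonzerodivisor modulo its predecessors, and the quotient by the
  whole sequence is nonzero.\<close>

definition regular_sequence :: "'a::comm_ring_1 list \<Rightarrow> bool" where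
  "regular_sequence fs \<longleftrightarrow>
     ideal.span (set fs) \<noteq> UNIV \<and>
     (\<forall>i<length fs. \<forall>r. fs ! i * r \<in> ideal.span (set (take i fs)) \<longrightarrow>
                        r \<in> ideal.span (set (take i fs)))"

definition complete_intersection :: "'a::comm_ring_1 set \<Rightarrow> bool" where
  "complete_intersection I \<longleftrightarrow> (\<exists>fs. regular_sequence fs \<and> I = ideal.span (set fs))"

definition directly_linked :: "'a::comm_ring_1 set \<Rightarrow> 'a set \<Rightarrow> bool" where
  "directly_linked I I' \<longleftrightarrow>
     ideal.subspace I \<and> I \<noteq> UNIV \<and> ideal.subspace I' \<and> I' \<noteq> UNIV \<and>
     (\<exists>L. complete_intersection L \<and> L \<subseteq> I \<inter> I' \<and>
          I' = colon_ideal L I \<and> I = colon_ideal L I')"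

definition in_linkage_class_of_ci :: "'a::comm_ring_1 set \<Rightarrow> bool" where
  "in_linkage_class_of_ci I \<longleftrightarrow> (\<exists>C. directly_linked\<^sup>*\<^sup>* I C \<and> complete_intersection C)"


text \<open>The index sets \<open>1 \<le> i < j \<le> 4\<close> and \<open>1 \<le> i < j < k \<le> 4\<close>, and the sixteen variables.\<close>

datatype pair = P12 | P13 | P14 | P23 | P24 | P34
datatype triple = T123 | T124 | T134 | T234
datatype var = X pair | Y pair | Z triple

text \<open>The polynomial ring \<open>A = K[x, y, z]\<close>, as finitely supported functions from monomials
  (exponent vectors) to coefficients, and \<open>B = A[t]\<close>.\<close>

type_synonym 'k ring_A = "(var \<Rightarrow>\<^sub>0 nat) \<Rightarrow>\<^sub>0 'k"
type_synonym 'k ring_B = "'k ring_A poly"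

definition Var :: "var \<Rightarrow> 'k::field ring_A" where
  "Var v = Poly_Mapping.single (Poly_Mapping.single v 1) 1"

abbreviation x :: "pair \<Rightarrow> 'k::field ring_A" where "x p \<equiv> Var (X p)"
abbreviation y :: "pair \<Rightarrow> 'k::field ring_A" where "y p \<equiv> Var (Y p)"
abbreviation z :: "triple \<Rightarrow> 'k::field ring_A" where "z q \<equiv> Var (Z q)"

definition \<Delta> :: "pair \<Rightarrow> pair \<Rightarrow> 'k::field ring_A" where
  "\<Delta> p q = x p * y q - x q * y p"

definition \<delta>1 :: "'k::field ring_A" where "\<delta>1 = \<Delta> P12 P34"
definition \<delta>2 :: "'k::field ring_A" where "\<delta>2 = \<Delta> P13 P24"
definition \<delta>3 :: "'k::field ring_A" where "\<delta>3 = \<Delta> P14 P23"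

definition u123 :: "'k::field ring_A" where
  "u123 = - 2 * z T234 * \<Delta> P12 P13 + 2 * z T134 * \<Delta> P12 P23
          - 2 * z T124 * \<Delta> P13 P23 + z T123 * (\<delta>2 - \<delta>1 + \<delta>3)"

definition u124 :: "'k::field ring_A" where
  "u124 = 2 * z T234 * \<Delta> P12 P14 - 2 * z T134 * \<Delta> P12 P24
          + z T124 * (\<delta>1 + \<delta>2 + \<delta>3) - 2 * z T123 * \<Delta> P14 P24"

definition u134 :: "'k::field ring_A" where
  "u134 = 2 * z T234 * \<Delta> P13 P14 + z T134 * (- \<delta>1 - \<delta>2 + \<delta>3)
          + 2 * z T124 * \<Delta> P13 P34 - 2 * z T123 * \<Delta> P14 P34"

definition u234 :: "'k::field ring_A" where
  "u234 = z T234 * (- \<delta>1 + \<delta>2 - \<delta>3) - 2 * z T134 * \<Delta> P23 P24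
          + 2 * z T124 * \<Delta> P23 P34 - 2 * z T123 * \<Delta> P24 P34"

definition a_poly :: "'k::field ring_A" where
  "a_poly = x P12 * x P34 - x P13 * x P24 + x P14 * x P23"

definition b_poly :: "'k::field ring_A" where
  "b_poly = x P12 * y P34 - x P13 * y P24 + x P14 * y P23
            + x P34 * y P12 - x P24 * y P13 + x P23 * y P14"

definition c_poly :: "'k::field ring_A" where
  "c_poly = y P12 * y P34 - y P13 * y P24 + y P14 * y P23"

definition u_poly :: "'k::field ring_A" where
  "u_poly = b_poly\<^sup>2 - 4 * a_poly * c_poly"

definition J :: "'k::field ring_A set" where
  "J = ideal.span {u234, u134, u124, u123, u_poly}"

definition t :: "'k::field ring_B" where "t = [:0, 1:]"

definition J_t :: "'k::field ring_B set" where
  "J_t = ideal.span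
     {[:u234:] - t * [:z T234:],
      [:u134:] - t * [:z T134:],
      [:u124:] - t * [:z T124:],
      [:u123:] + t * [:z T123:],
      [:u_poly:] - t\<^sup>2}"

hide_const (open) x y z t

end

(*
Read x and y as skew 4x4 matrices X, Y and z as a vector in the dual space. Up to signs the u's are
the entries of M z, where M = X Y* - Y X* (Y* the Pfaffian adjoint) satisfies M^2 = u, so J(t) is
generated by (M - t) z and u - t^2, and J is the same with t = 0. Split off one coordinate of the
4-space: X becomes a pair of 3-vectors (xi, alpha), Y becomes (eta, beta), z becomes (v, v4). The
first three entries of (M - t) z are F = 2 (xi.v) beta - 2 (eta.v) alpha + k, where
k = 2 v4 (xi x eta) - sigma v and sigma = t + xi.beta - eta.alpha. Three links lead to a complete
intersection:
  J(t) --- (F1, F2, F3) --- (xi.v, eta.v, k1, k2, k3)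
       --- (xi.v, eta.v, k1) --- v1 and the 2x2 minors of a generic 2x3 matrix
       --- (v1, G2, G3) --- (v1, v2, v3).
All nonzerodivisor statements come from two devices: exchanging two members of a regular sequence,
and substitutions V -> V + T e(V) that fix the ideal while adding to g a multiple T l of T with l a
known nonzerodivisor.
*)

theory Submission
  imports Defs
begin

text \<open>As a rewrite rule this instance of \<open>scale_scale\<close> reverses associativity and loops with
  \<open>algebra_simps\<close>.\<close>

declare ideal.scale_scale [simp del]

section \<open>Ideals generated by few elements\<close>

lemma span1_iff: "r \<in> ideal.span {a} \<longleftrightarrow> (\<exists>x. r = x * a)"
  by (auto simp: ideal.span_singleton)

lemma span_insert_iff: "r \<in> ideal.span (insert a S) \<longleftrightarrow> (\<exists>x. \<exists>s\<in>ideal.span S. r = x * a + s)"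
proof -
  have "r - x * a \<in> ideal.span S \<longleftrightarrow> (\<exists>s\<in>ideal.span S. r = x * a + s)" for x
    by (metis add_diff_cancel_left' diff_add_cancel add.commute)
  then show ?thesis
    by (simp add: ideal.span_breakdown_eq)
qed

lemma span2_iff: "r \<in> ideal.span {a, b} \<longleftrightarrow> (\<exists>x y. r = x * a + y * b)"
proof -
  have "(\<exists>s\<in>ideal.span {b}. r = x * a + s) \<longleftrightarrow> (\<exists>y. r = x * a + y * b)" for x
    by (auto simp: span1_iff)
  then show ?thesis by (simp only: span_insert_iff[of r a])
qed

lemma span3_iff: "r \<in> ideal.span {a, b, c} \<longleftrightarrow> (\<exists>x y z. r = x * a + y * b + z * c)"
proof -
  have "(\<exists>s\<in>ideal.span {b, c}. r = x * a + s) \<longleftrightarrow> (\<exists>y z. r = x * a + y * b + z * c)" for x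
    unfolding Bex_def span2_iff by (auto simp: add.assoc)
  then show ?thesis by (simp only: span_insert_iff[of r a])
qed

lemma span_subset_iff: "ideal.span S \<subseteq> ideal.span T \<longleftrightarrow> S \<subseteq> ideal.span T"
  by (meson ideal.span_minimal ideal.span_superset ideal.subspace_span order_trans)

lemma span_mult_left: "a \<in> S \<Longrightarrow> a * b \<in> ideal.span S"
  using ideal.span_scale[OF ideal.span_base, of a S b] by (simp add: mult.commute)

lemma span_mult_eq:
  "a * b = x * c + y * d + z * e \<Longrightarrow> {c, d, e} \<subseteq> S \<Longrightarrow> a * b \<in> ideal.span S"
  by (simp add: ideal.span_add ideal.span_scale ideal.span_base)

lemma span_mult_subset:
  assumes "\<And>a b. a \<in> S \<Longrightarrow> b \<in> T \<Longrightarrow> a * b \<in> ideal.span L"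
    and "r \<in> ideal.span S" and "s \<in> ideal.span T"
  shows "r * s \<in> ideal.span L"
proof -
  have *: "a * s \<in> ideal.span L" if "a \<in> S" for a
    using assms(3)
  proof (induction rule: ideal.span_induct_alt)
    case (step c x y)
    then show ?case
      using assms(1)[OF that, of x]
      by (metis (no_types) distrib_left ideal.span_add ideal.span_scale mult.left_commute)
  qed (simp add: ideal.span_zero)
  from assms(2) show ?thesis
  proof (induction rule: ideal.span_induct_alt)
    case (step c x y)
    then show ?case
      using *[of x]
      by (metis (no_types) distrib_right ideal.span_add ideal.span_scale mult.assoc)
  qed (simp add: ideal.span_zero)
qed


subsection \<open>Nonzerodivisors modulo an ideal\<close>

definition nzd :: "'a::comm_ring_1 \<Rightarrow> 'a set \<Rightarrow> bool" where
  "nzd g M \<longleftrightarrow> (\<forall>r. g * r \<in> M \<longrightarrow> r \<in> M)"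

lemma nzdD: "nzd g M \<Longrightarrow> g * r \<in> M \<Longrightarrow> r \<in> M"
  by (simp add: nzd_def)

lemma nzd_one: "nzd 1 M"
  by (simp add: nzd_def)

lemma nzd_mult: "nzd g M \<Longrightarrow> nzd h M \<Longrightarrow> nzd (g * h) M"
  unfolding nzd_def mult.assoc by blast

lemma nzd_uminus: "nzd g (ideal.span S) \<Longrightarrow> nzd (- g) (ideal.span S)"
  unfolding nzd_def using ideal.span_neg by fastforce

lemma nzd_unit:
  assumes "u * g = 1"
  shows "nzd g (ideal.span S)"
  unfolding nzd_def
proof (intro allI impI)
  fix r assume "g * r \<in> ideal.span S"
  then have "u * (g * r) \<in> ideal.span S" by (rule ideal.span_scale)
  then show "r \<in> ideal.span S" using assms by (simp add: mult.assoc[symmetric])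
qed

lemma nzd_cong:
  assumes "nzd g (ideal.span S)" and "h - g \<in> ideal.span S"
  shows "nzd h (ideal.span S)"
  unfolding nzd_def
proof (intro allI impI)
  fix r assume "h * r \<in> ideal.span S"
  moreover have "(h - g) * r \<in> ideal.span S"
    using ideal.span_scale[OF assms(2), of r] by (simp add: mult.commute)
  ultimately have "h * r - (h - g) * r \<in> ideal.span S" by (rule ideal.span_diff)
  moreover have "h * r - (h - g) * r = g * r" by (simp add: algebra_simps)
  ultimately show "r \<in> ideal.span S"
    using assms(1) nzdD by metis
qed

text \<open>Work modulo \<open>S\<close> and let \<open>w * r = c * g\<close>. Regularity of
  \<open>g\<close> modulo \<open>w\<close> gives \<open>c = d * w\<close>, and cancelling
  \<open>w\<close> leaves \<open>r = d * g\<close>.\<close>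

lemma nzd_swap:
  assumes "nzd g (ideal.span (insert w S))" and "nzd w (ideal.span S)"
  shows "nzd w (ideal.span (insert g S))"
  unfolding nzd_def
proof (intro allI impI)
  fix r assume "w * r \<in> ideal.span (insert g S)"
  then obtain c where c: "w * r - c * g \<in> ideal.span S"
    by (auto simp: ideal.span_breakdown_eq)
  have "g * c = r * w - (w * r - c * g)" by (simp add: algebra_simps)
  also have "\<dots> \<in> ideal.span (insert w S)"
  proof (rule ideal.span_diff)
    show "r * w \<in> ideal.span (insert w S)"
      by (simp add: ideal.span_scale ideal.span_base)
    show "w * r - c * g \<in> ideal.span (insert w S)"
      using c ideal.span_mono[OF subset_insertI] by blast
  qed
  finally have "c \<in> ideal.span (insert w S)"
    using assms(1) nzdD by blast
  then obtain d where d: "c - d * w \<in> ideal.span S"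
    by (auto simp: ideal.span_breakdown_eq)
  have "w * (r - d * g) = (w * r - c * g) + g * (c - d * w)" by (simp add: algebra_simps)
  also have "\<dots> \<in> ideal.span S"
    using c d by (intro ideal.span_add ideal.span_scale)
  finally have "r - d * g \<in> ideal.span S"
    using assms(2) nzdD by blast
  then show "r \<in> ideal.span (insert g S)"
    by (auto simp: ideal.span_breakdown_eq)
qed

section \<open>Koszul relations and vector products\<close>

lemma koszul2:
  assumes "nzd P (ideal.span {})" and "nzd Q (ideal.span {P})" and "A * P + B * Q = 0"
  obtains E where "A = E * Q" and "B = - E * P"
proof -
  have "Q * B = (- A) * P"
    using assms(3) by (simp add: algebra_simps eq_neg_iff_add_eq_0)
  then have "B \<in> ideal.span {P}"
    using assms(2) by (metis nzdD span1_iff)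
  then obtain E where E: "B = E * P" by (auto simp: span1_iff)
  have "P * (A + E * Q) \<in> ideal.span {}" using assms(3) by (simp add: E algebra_simps)
  then have "A + E * Q = 0" using nzdD[OF assms(1)] by simp
  then have "A = - E * Q" by (simp add: eq_neg_iff_add_eq_0)
  with E show ?thesis by (intro that[of "- E"]) auto
qed

text \<open>Exactness of the Koszul complex: regularity of \<open>c\<close> puts \<open>h3\<close>
  into the ideal of \<open>a\<close> and \<open>b\<close>, and removing that part leaves a relation
  for \<open>koszul2\<close>. The result reads h = w x (a, b, c).\<close>

lemma koszul3:
  assumes "nzd a (ideal.span {})" and "nzd b (ideal.span {a})" and "nzd c (ideal.span {a, b})"
    and "h1 * a + h2 * b + h3 * c = 0"
  obtains w1 w2 w3 where "h1 = w2 * c - w3 * b" "h2 = w3 * a - w1 * c" "h3 = w1 * b - w2 * a"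
proof -
  have "c * h3 = (- h1) * a + (- h2) * b"
    using assms(4) by (simp add: algebra_simps eq_neg_iff_add_eq_0)
  then have "h3 \<in> ideal.span {a, b}"
    using assms(3) by (metis nzdD span2_iff)
  then obtain A B where h3: "h3 = A * a + B * b" by (auto simp: span2_iff)
  have "(h1 + A * c) * a + (h2 + B * c) * b = 0"
    using assms(4) by (simp add: h3 algebra_simps)
  then obtain E where "h1 + A * c = E * b" "h2 + B * c = - E * a"
    using koszul2[OF assms(1,2)] by blast
  then have "h1 = E * b - A * c" "h2 = - E * a - B * c"
    by (simp_all add: eq_diff_eq)
  with h3 show ?thesis
    by (intro that[of "- A" "- E" B]) (simp_all add: algebra_simps)
qed

text \<open>The two lemmas below concern \<open>k = p \<xi> \<times> \<eta> - \<sigma> v\<close>. They rest on the congruence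
  \<open>v\<^sub>i k\<^sub>j \<equiv> v\<^sub>j k\<^sub>i\<close> modulo \<open>P = \<xi> \<cdot> v\<close> and \<open>Q = \<eta> \<cdot> v\<close>.\<close>

lemma cross_syzygy:
  fixes v1 v2 v3 :: "'a::comm_ring_1"
  assumes k: "k1 = p * (\<xi>2 * \<eta>3 - \<xi>3 * \<eta>2) - \<sigma> * v1"
      "k2 = p * (\<xi>3 * \<eta>1 - \<xi>1 * \<eta>3) - \<sigma> * v2"
      "k3 = p * (\<xi>1 * \<eta>2 - \<xi>2 * \<eta>1) - \<sigma> * v3"
    and PQ: "P = \<xi>1 * v1 + \<xi>2 * v2 + \<xi>3 * v3" "Q = \<eta>1 * v1 + \<eta>2 * v2 + \<eta>3 * v3"
    and k1: "nzd k1 (ideal.span {P, Q})"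
    and v: "nzd v1 (ideal.span {})" "nzd v2 (ideal.span {v1})" "nzd v3 (ideal.span {v1, v2})"
    and h: "h1 * k1 + h2 * k2 + h3 * k3 \<in> ideal.span {P, Q}"
  obtains A B w1 w2 w3 where
    "h1 = A * \<xi>1 + B * \<eta>1 + (w2 * v3 - w3 * v2)"
    "h2 = A * \<xi>2 + B * \<eta>2 + (w3 * v1 - w1 * v3)"
    "h3 = A * \<xi>3 + B * \<eta>3 + (w1 * v2 - w2 * v1)"
proof -
  \<comment> \<open>The congruence turns v1 (h . k) into k1 (h . v), so that \<open>k1\<close> can
    be cancelled.\<close>
  have "k1 * (h1 * v1 + h2 * v2 + h3 * v3) =
      v1 * (h1 * k1 + h2 * k2 + h3 * k3) +
      (p * (\<eta>3 * h2 - \<eta>2 * h3) * P + p * (\<xi>2 * h3 - \<xi>3 * h2) * Q)"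
    by (simp add: k PQ algebra_simps)
  also have "\<dots> \<in> ideal.span {P, Q}"
    by (rule ideal.span_add[OF ideal.span_scale[OF h]]) (auto simp: span2_iff)
  finally have "h1 * v1 + h2 * v2 + h3 * v3 \<in> ideal.span {P, Q}"
    using k1 nzdD by blast
  then obtain A B where "h1 * v1 + h2 * v2 + h3 * v3 = A * P + B * Q"
    by (auto simp: span2_iff)
  \<comment> \<open>Since \<open>P\<close> = \<xi> . v and \<open>Q\<close> = \<eta> . v, the vector
    h - A \<xi> - B \<eta> is orthogonal to v, hence a vector product with v.\<close>
  then have "(h1 - A * \<xi>1 - B * \<eta>1) * v1 + (h2 - A * \<xi>2 - B * \<eta>2) * v2
      + (h3 - A * \<xi>3 - B * \<eta>3) * v3 = 0"
    by (simp add: PQ algebra_simps)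
  from koszul3[OF v this] obtain w1 w2 w3 where
    "h1 - A * \<xi>1 - B * \<eta>1 = w2 * v3 - w3 * v2" "h2 - A * \<xi>2 - B * \<eta>2 = w3 * v1 - w1 * v3"
    "h3 - A * \<xi>3 - B * \<eta>3 = w1 * v2 - w2 * v1"
    by blast
  then show ?thesis
    by (intro that[of A B w2 w3 w1]) (simp_all add: diff_eq_eq add_ac)
qed

lemma cross_colon:
  fixes v1 v2 v3 :: "'a::comm_ring_1"
  assumes k: "k1 = p * (\<xi>2 * \<eta>3 - \<xi>3 * \<eta>2) - \<sigma> * v1"
      "k2 = p * (\<xi>3 * \<eta>1 - \<xi>1 * \<eta>3) - \<sigma> * v2"
      "k3 = p * (\<xi>1 * \<eta>2 - \<xi>2 * \<eta>1) - \<sigma> * v3"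
    and PQ: "P = \<xi>1 * v1 + \<xi>2 * v2 + \<xi>3 * v3" "Q = \<eta>1 * v1 + \<eta>2 * v2 + \<eta>3 * v3"
    and v1: "nzd v1 (ideal.span {P, Q})" and k1: "nzd k1 (ideal.span {v1, v2, v3})"
    and r: "v1 * r \<in> ideal.span {P, Q, k1}"
  shows "r \<in> ideal.span {P, Q, k1, k2, k3}"
proof -
  obtain A B C where C: "v1 * r = A * P + B * Q + C * k1"
    using r by (auto simp: span3_iff)
  have "k1 * C = (r - A * \<xi>1 - B * \<eta>1) * v1 + (- A * \<xi>2 - B * \<eta>2) * v2
      + (- A * \<xi>3 - B * \<eta>3) * v3"
    using C by (simp add: PQ algebra_simps)
  then have "C \<in> ideal.span {v1, v2, v3}"
    using k1 by (metis nzdD span3_iff)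
  then obtain C1 C2 C3 where C': "C = C1 * v1 + C2 * v2 + C3 * v3"
    by (auto simp: span3_iff)
  \<comment> \<open>Modulo \<open>P\<close> and \<open>Q\<close> the congruence replaces
    \<open>C * k1\<close> by \<open>v1 * ?k\<close>, after which \<open>v1\<close> can be
    cancelled.\<close>
  let ?k = "C1 * k1 + C2 * k2 + C3 * k3"
  have "v1 * (r - ?k) = (A * P + B * Q + C * k1) - v1 * ?k"
    by (simp only: right_diff_distrib C)
  also have "\<dots> = (A + p * (\<eta>3 * C2 - \<eta>2 * C3)) * P + (B + p * (\<xi>2 * C3 - \<xi>3 * C2)) * Q"
    by (simp add: C' k PQ algebra_simps)
  finally have "r - ?k \<in> ideal.span {P, Q}"
    using v1 by (metis nzdD span2_iff)
  then have "r - ?k \<in> ideal.span {P, Q, k1, k2, k3}"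
    by (rule subsetD[OF ideal.span_mono, rotated]) auto
  moreover have "?k \<in> ideal.span {P, Q, k1, k2, k3}"
    by (intro ideal.span_add ideal.span_scale ideal.span_base) auto
  ultimately show ?thesis
    using ideal.span_add by fastforce
qed

text \<open>If a ring map to polynomials preserves an ideal, the leading coefficient of the image of \<open>g\<close>
  controls whether \<open>g\<close> is a nonzerodivisor: look at the highest coefficient of the
  image of \<open>r\<close> that lies outside the ideal.\<close>

lemma nzd_lead_coeff:
  fixes \<Phi> :: "'a::comm_ring_1 \<Rightarrow> 'a poly"
  assumes add: "\<And>a b. \<Phi> (a + b) = \<Phi> a + \<Phi> b" and mult: "\<And>a b. \<Phi> (a * b) = \<Phi> a * \<Phi> b"
    and at_0: "\<And>r. coeff (\<Phi> r) 0 = r"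
    and gens: "\<And>s i. s \<in> S \<Longrightarrow> coeff (\<Phi> s) i \<in> ideal.span S"
    and g: "\<Phi> g = [:g, l:]" and l: "nzd l (ideal.span S)"
  shows "nzd g (ideal.span S)"
  unfolding nzd_def
proof (intro allI impI)
  fix r assume gr: "g * r \<in> ideal.span S"
  have inv: "\<forall>i. coeff (\<Phi> s) i \<in> ideal.span S" if "s \<in> ideal.span S" for s
    using that
  proof (induction rule: ideal.span_induct_alt)
    case base
    have "\<Phi> 0 = 0" using add[of 0 0] by simp
    then show ?case by (simp add: ideal.span_zero)
  next
    case (step c x y)
    then show ?case
      by (simp add: add mult coeff_mult ideal.span_add ideal.span_sum ideal.span_scale gens)
  qed
  have "coeff (\<Phi> r) i \<in> ideal.span S" for i
  proof (induction "degree (\<Phi> r) - i" arbitrary: i rule: less_induct)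
    case less
    show ?case
    proof (cases "i \<le> degree (\<Phi> r)")
      case True
      have next_coeff: "coeff (\<Phi> r) (Suc i) \<in> ideal.span S"
        using True less[of "Suc i"]
        by (cases "i = degree (\<Phi> r)") (auto simp: coeff_eq_0 ideal.span_zero)
      have "coeff (\<Phi> (g * r)) (Suc i) = l * coeff (\<Phi> r) i + g * coeff (\<Phi> r) (Suc i)"
        by (simp add: mult g mult_pCons_left)
      then have "l * coeff (\<Phi> r) i + g * coeff (\<Phi> r) (Suc i) \<in> ideal.span S"
        using inv[OF gr] by metis
      then have "l * coeff (\<Phi> r) i \<in> ideal.span S"
        using ideal.span_scale[OF next_coeff, of g] ideal.span_add_eq2 by blast
      then show ?thesis
        using l nzdD by blast
    qed (simp add: coeff_eq_0 ideal.span_zero)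
  qed
  from this[of 0] show "r \<in> ideal.span S"
    by (simp add: at_0)
qed

subsection \<open>Regular sequences and direct linkage\<close>

lemma regular_sequence3:
  assumes "nzd a (ideal.span {})" "nzd b (ideal.span {a})" "nzd c (ideal.span {b, a})"
    and "1 \<notin> ideal.span {c, b, a}"
  shows "regular_sequence [a, b, c]"
proof -
  have "[a, b, c] ! i * r \<in> ideal.span (set (take i [a, b, c])) \<longrightarrow>
      r \<in> ideal.span (set (take i [a, b, c]))" if i: "i < 3" for i :: nat and r
  proof -
    consider "i = 0" | "i = 1" | "i = 2" using i by linarith
    then show ?thesis
      using assms(1-3) unfolding nzd_def by cases (simp_all add: insert_commute)
  qed
  then show ?thesis
    using assms(4) unfolding regular_sequence_def by (auto simp: insert_commute)
qed

text \<open>Each colon ideal is tested on one element: L : (S) lies in L : g, hence in (S'), and the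
  products of generators give the reverse inclusion. Since L lies in both ideals, a generator of one
  that is regular modulo the other is a valid test element.\<close>

lemma directly_linkedI:
  assumes "regular_sequence fs" and "S'' = set fs"
    and proper: "1 \<notin> ideal.span S" "1 \<notin> ideal.span S'"
    and sub: "S'' \<subseteq> ideal.span S" "S'' \<subseteq> ideal.span S'"
    and prod: "\<And>a b. a \<in> S \<Longrightarrow> b \<in> S' \<Longrightarrow> a * b \<in> ideal.span S''"
    and colon: "g \<in> S" "\<And>r. g * r \<in> ideal.span S'' \<Longrightarrow> r \<in> ideal.span S'"
    and colon': "g' \<in> S'" "\<And>r. g' * r \<in> ideal.span S'' \<Longrightarrow> r \<in> ideal.span S"
  shows "directly_linked (ideal.span S) (ideal.span S')"
proof -
  have *: "colon_ideal (ideal.span S'') (ideal.span A) = ideal.span B"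
    if prod': "\<And>a b. a \<in> A \<Longrightarrow> b \<in> B \<Longrightarrow> a * b \<in> ideal.span S''"
      and colon': "h \<in> A" "\<And>r. h * r \<in> ideal.span S'' \<Longrightarrow> r \<in> ideal.span B" for A B h
  proof
    show "colon_ideal (ideal.span S'') (ideal.span A) \<subseteq> ideal.span B"
      using colon' ideal.span_base[of h A]
      by (auto simp: colon_ideal_def mult.commute[of _ h])
    have "r * a \<in> ideal.span S''" if "a \<in> ideal.span A" "r \<in> ideal.span B" for a r
      using span_mult_subset[OF prod' that] by (simp add: mult.commute)
    then show "ideal.span B \<subseteq> colon_ideal (ideal.span S'') (ideal.span A)"
      by (auto simp: colon_ideal_def)
  qed
  have prod': "b * a \<in> ideal.span S''" if "b \<in> S'" "a \<in> S" for a b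
    using prod[OF that(2,1)] by (simp add: mult.commute)
  have "complete_intersection (ideal.span S'')"
    using assms(1,2) by (auto simp: complete_intersection_def)
  moreover have "ideal.span S'' \<subseteq> ideal.span S \<inter> ideal.span S'"
    using sub by (simp add: span_subset_iff)
  moreover have "ideal.span S' = colon_ideal (ideal.span S'') (ideal.span S)"
    using *[OF prod colon] by simp
  moreover have "ideal.span S = colon_ideal (ideal.span S'') (ideal.span S')"
    using *[OF prod' colon'] by simp
  ultimately show ?thesis
    unfolding directly_linked_def using proper by blast
qed


subsection \<open>Pencils of skew forms\<close>

text \<open>\<open>V\<close> gives the sixteen variables up to sign, \<open>shift e\<close> is the substitution
  \<open>V v \<mapsto> V v + T e(v)\<close> into polynomials in \<open>T\<close>, and \<open>aug\<close> only serves to see that the ideals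
  are proper. Both \<open>A\<close> (with \<open>t = 0\<close>) and \<open>B\<close> are instances.\<close>

locale pencil =
  fixes V :: "var \<Rightarrow> 'a::comm_ring_1" and t :: 'a and shift :: "(var \<Rightarrow> 'a) \<Rightarrow> 'a \<Rightarrow> 'a poly"
    and aug :: "'a set"
  assumes two_unit: "\<exists>h. h * 2 = (1::'a)"
    and shift_1 [simp]: "shift e 1 = 1"
    and shift_add [simp]: "shift e (r + s) = shift e r + shift e s"
    and shift_mult [simp]: "shift e (r * s) = shift e r * shift e s"
    and shift_V [simp]: "shift e (V v) = [:V v, e v:]"
    and shift_t [simp]: "shift e t = [:t:]"
    and coeff_shift_0: "coeff (shift e r) 0 = r"
    and subspace_aug: "ideal.subspace aug" and one_aug: "1 \<notin> aug"
    and V_aug: "V v \<in> aug" and t_aug: "t \<in> aug"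
begin

lemma shift_0 [simp]: "shift e 0 = 0"
  using shift_add[of e 0 0] by simp

lemma shift_uminus [simp]: "shift e (- r) = - shift e r"
  using shift_add[of e r "- r"] by (simp add: eq_neg_iff_add_eq_0 add.commute)

lemma shift_diff [simp]: "shift e (r - s) = shift e r - shift e s"
  using shift_add[of e r "- s"] by simp

lemma shift_2 [simp]: "shift e 2 = [:2:]"
  using shift_add[of e 1 1] by (simp add: one_pCons)

lemma nzd_2: "nzd (2::'a) (ideal.span S)"
  using two_unit nzd_unit by blast

text \<open>Generators may move as long as their \<open>T\<close>-coefficients stay in the ideal;
  \<open>nzd_shift\<close> is the case where they are fixed.\<close>

lemma nzd_shift':
  assumes "nzd l (ideal.span S)" and "shift e g = [:g, l:]"
    and "\<And>s. s \<in> S \<Longrightarrow> \<exists>r\<in>ideal.span S. shift e s = [:s, r:]"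
  shows "nzd g (ideal.span S)"
proof (rule nzd_lead_coeff[where \<Phi> = "shift e"])
  fix s i assume "s \<in> S"
  with assms(3) obtain r where r: "r \<in> ideal.span S" "shift e s = [:s, r:]" by blast
  then show "coeff (shift e s) i \<in> ideal.span S"
    using ideal.span_base[OF \<open>s \<in> S\<close>] ideal.span_zero[of S]
    by (auto simp: coeff_pCons split: nat.split)
qed (use assms in \<open>simp_all add: coeff_shift_0\<close>)

lemma nzd_shift:
  assumes "nzd l (ideal.span S)" and "shift e g = [:g, l:]" and "\<forall>s\<in>S. shift e s = [:s:]"
  shows "nzd g (ideal.span S)"
  using assms(1,2) by (rule nzd_shift') (use assms(3) ideal.span_zero in auto)

abbreviation along :: "var \<Rightarrow> var \<Rightarrow> 'a" where
  "along w \<equiv> (\<lambda>_. 0)(w := 1)"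

text \<open>Moving \<open>V w\<close> alone adds \<open>T\<close> times 1, so a variable absent from
  the generators is regular.\<close>

lemma nzd_V: "\<forall>s\<in>S. shift (along w) s = [:s:] \<Longrightarrow> nzd (V w) (ideal.span S)"
  by (rule nzd_shift[OF nzd_one, where e = "along w"]) auto

text \<open>Combines both devices: a shift makes \<open>g\<close> regular modulo \<open>w\<close>
  and \<open>S\<close>, then \<open>g\<close> and \<open>w\<close> change places.\<close>

lemma nzd_swap_shift:
  assumes "nzd l (ideal.span (insert w S))" and "nzd w (ideal.span S)"
    and "shift e g = [:g, l:]" and "\<forall>s\<in>insert w S. shift e s = [:s:]"
  shows "nzd w (ideal.span (insert g S))"
  using nzd_swap[OF nzd_shift[OF assms(1,3,4)] assms(2)] .

text \<open>Index 4 is split off: \<xi> and \<eta> collect the entries at the pairs {i, 4}, \<alpha>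
  and \<beta> those at the complementary pairs, and \<open>v1\<close> to \<open>v4\<close> belong to
  the triples omitting 1 to 4.\<close>

abbreviation "\<xi>1 \<equiv> V (X P14)"
abbreviation "\<xi>2 \<equiv> V (X P24)"
abbreviation "\<xi>3 \<equiv> V (X P34)"
abbreviation "\<alpha>1 \<equiv> V (X P23)"
abbreviation "\<alpha>2 \<equiv> V (X P13)"
abbreviation "\<alpha>3 \<equiv> V (X P12)"
abbreviation "\<eta>1 \<equiv> V (Y P14)"
abbreviation "\<eta>2 \<equiv> V (Y P24)"
abbreviation "\<eta>3 \<equiv> V (Y P34)"
abbreviation "\<beta>1 \<equiv> V (Y P23)"
abbreviation "\<beta>2 \<equiv> V (Y P13)"
abbreviation "\<beta>3 \<equiv> V (Y P12)"
abbreviation "v1 \<equiv> V (Z T234)"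
abbreviation "v2 \<equiv> V (Z T134)"
abbreviation "v3 \<equiv> V (Z T124)"
abbreviation "v4 \<equiv> V (Z T123)"

definition "P = \<xi>1 * v1 + \<xi>2 * v2 + \<xi>3 * v3"
definition "Q = \<eta>1 * v1 + \<eta>2 * v2 + \<eta>3 * v3"
definition "\<xi>\<alpha> = \<xi>1 * \<alpha>1 + \<xi>2 * \<alpha>2 + \<xi>3 * \<alpha>3"
definition "\<xi>\<beta> = \<xi>1 * \<beta>1 + \<xi>2 * \<beta>2 + \<xi>3 * \<beta>3"
definition "\<eta>\<alpha> = \<eta>1 * \<alpha>1 + \<eta>2 * \<alpha>2 + \<eta>3 * \<alpha>3"
definition "\<eta>\<beta> = \<eta>1 * \<beta>1 + \<eta>2 * \<beta>2 + \<eta>3 * \<beta>3"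
definition "\<sigma> = t + \<xi>\<beta> - \<eta>\<alpha>"
definition "m = \<xi>2 * \<eta>3 - \<xi>3 * \<eta>2"
definition "k1 = 2 * v4 * (\<xi>2 * \<eta>3 - \<xi>3 * \<eta>2) - \<sigma> * v1"
definition "k2 = 2 * v4 * (\<xi>3 * \<eta>1 - \<xi>1 * \<eta>3) - \<sigma> * v2"
definition "k3 = 2 * v4 * (\<xi>1 * \<eta>2 - \<xi>2 * \<eta>1) - \<sigma> * v3"
definition "F1 = 2 * \<beta>1 * P - 2 * \<alpha>1 * Q + k1"
definition "F2 = 2 * \<beta>2 * P - 2 * \<alpha>2 * Q + k2"
definition "F3 = 2 * \<beta>3 * P - 2 * \<alpha>3 * Q + k3"
text \<open>In the rings A and B this becomes the negative of the generator
  \<open>u123 + t * z T123\<close>, and \<open>D\<close> becomes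
  \<open>u_poly - t^2\<close>.\<close>

definition "F4 = 2 * (v1 * (\<alpha>3 * \<beta>2 - \<alpha>2 * \<beta>3) + v2 * (\<alpha>1 * \<beta>3 - \<alpha>3 * \<beta>1)
    + v3 * (\<alpha>2 * \<beta>1 - \<alpha>1 * \<beta>2)) - v4 * (t + \<eta>\<alpha> - \<xi>\<beta>)"
definition "D = (\<xi>\<beta> + \<eta>\<alpha>)^2 - 4 * \<xi>\<alpha> * \<eta>\<beta> - t^2"

lemmas PQ_defs = P_def Q_def
lemmas k_defs = k1_def k2_def k3_def \<sigma>_def \<xi>\<beta>_def \<eta>\<alpha>_def
lemmas F_defs = F1_def F2_def F3_def F4_def

section \<open>Regularity of \<open>P\<close>, \<open>Q\<close>, \<open>k1\<close>, and of
  \<open>F4\<close> modulo them\<close>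

lemma nzd_P: "nzd P (ideal.span {})"
  by (rule nzd_shift[where e = "along (X P14)" and l = v1]; (rule nzd_V)?; simp add: P_def)

text \<open>In each exchange an entry of \<xi> absent from the other generators is shifted. This
  adds to \<open>P\<close> the multiple \<open>T\<close> of an entry of v, a variable that those
  generators do not contain.\<close>

lemma nzd_mod_P:
  "nzd v1 (ideal.span {P})" "nzd v2 (ideal.span {P})" "nzd \<xi>1 (ideal.span {P})"
  "nzd v2 (ideal.span {P, v1})" "nzd v1 (ideal.span {P, v2})" "nzd v1 (ideal.span {P, \<xi>1})"
  "nzd \<xi>2 (ideal.span {P, \<xi>1})" "nzd v1 (ideal.span {P, \<xi>2, \<xi>1})"
  "nzd v2 (ideal.span {P, v1, \<xi>1})" "nzd v1 (ideal.span {P, \<eta>3, v2})"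
proof -
  show "nzd v1 (ideal.span {P})"
    by (rule nzd_swap_shift[where e = "along (X P24)" and l = v2]; (rule nzd_V)?; simp add: P_def)
  show "nzd v2 (ideal.span {P})"
    by (rule nzd_swap_shift[where e = "along (X P14)" and l = v1]; (rule nzd_V)?; simp add: P_def)
  show "nzd \<xi>1 (ideal.span {P})"
    by (rule nzd_swap_shift[where e = "along (X P24)" and l = v2]; (rule nzd_V)?; simp add: P_def)
  show "nzd v2 (ideal.span {P, v1})" "nzd v1 (ideal.span {P, v2})"
    by (rule nzd_swap_shift[where e = "along (X P34)" and l = v3]; (rule nzd_V)?; simp add: P_def)+
  show "nzd v1 (ideal.span {P, \<xi>1})"
    by (rule nzd_swap_shift[where e = "along (X P24)" and l = v2]; (rule nzd_V)?; simp add: P_def)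
  show "nzd \<xi>2 (ideal.span {P, \<xi>1})" "nzd v1 (ideal.span {P, \<xi>2, \<xi>1})"
    "nzd v2 (ideal.span {P, v1, \<xi>1})" "nzd v1 (ideal.span {P, \<eta>3, v2})"
    by (rule nzd_swap_shift[where e = "along (X P34)" and l = v3]; (rule nzd_V)?; simp add: P_def)+
qed

lemma nzd_Q: "nzd Q (ideal.span {P})"
  by (rule nzd_shift[OF nzd_mod_P(1), where e = "along (Y P14)"]) (simp_all add: PQ_defs)

lemma nzd_mod_PQ:
  "nzd v1 (ideal.span {Q, P})" "nzd v2 (ideal.span {Q, P})" "nzd \<xi>1 (ideal.span {Q, P})"
  "nzd v1 (ideal.span {Q, \<xi>1, P})" "nzd \<xi>2 (ideal.span {Q, \<xi>1, P})"
  "nzd \<eta>3 (ideal.span {Q, P, v2})"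
proof -
  note swap_shift_Q = nzd_swap_shift[where g = Q]
  note [simp] = nzd_mod_P insert_commute[of _ P]
  show "nzd v1 (ideal.span {Q, P})"
    by (rule swap_shift_Q[where e = "along (Y P24)" and l = v2]; (simp; fail)?; simp add: PQ_defs)
  show "nzd v2 (ideal.span {Q, P})" "nzd \<xi>1 (ideal.span {Q, P})"
    by (rule swap_shift_Q[where e = "along (Y P14)" and l = v1]; (simp; fail)?; simp add: PQ_defs)+
  show "nzd v1 (ideal.span {Q, \<xi>1, P})"
    by (rule swap_shift_Q[where e = "along (Y P24)" and l = v2]; (simp; fail)?; simp add: PQ_defs)
  show "nzd \<xi>2 (ideal.span {Q, \<xi>1, P})"
    by (rule swap_shift_Q[where e = "along (Y P14)" and l = v1]; (simp; fail)?; simp add: PQ_defs)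
  have "nzd \<eta>3 (ideal.span {P, v2})"
    by (rule nzd_V) (simp add: P_def)
  then show "nzd \<eta>3 (ideal.span {Q, P, v2})"
    by (rule swap_shift_Q[where e = "along (Y P14)" and l = v1, rotated];
        (simp; fail)?; simp add: PQ_defs)
qed

text \<open>The entry \<open>\<beta>1\<close> enters only through \<open>\<sigma>\<close>, so
  shifting it moves \<open>k1\<close> by \<open>T\<close> times \<open>- (v1 * \<xi>1)\<close> and
  fixes \<open>P\<close> and \<open>Q\<close>.\<close>

lemma nzd_k1: "nzd k1 (ideal.span {Q, P})"
  using nzd_uminus[OF nzd_mult[OF nzd_mod_PQ(1,3)]]
  by (rule nzd_shift[where e = "along (Y P23)"]) (simp_all add: PQ_defs k_defs algebra_simps)

text \<open>Shifting \<open>\<xi>2\<close> adds \<open>T * \<eta>3\<close> to \<open>m\<close>. It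
  moves \<open>P\<close> as well, but by \<open>T * v2\<close>, and \<open>v2\<close> is a
  generator.\<close>

lemma nzd_m: "nzd m (ideal.span {v2, Q, P})"
proof (rule nzd_shift'[where e = "along (X P24)" and l = \<eta>3])
  show "nzd \<eta>3 (ideal.span {v2, Q, P})"
    using nzd_mod_PQ(6) by (simp add: insert_commute)
  fix s assume "s \<in> {v2, Q, P}"
  moreover have "v2 \<in> ideal.span {v2, Q, P}" "0 \<in> ideal.span {v2, Q, P}"
    by (simp_all add: ideal.span_base ideal.span_zero)
  moreover have "shift (along (X P24)) P = [:P, v2:]"
    by (simp add: P_def)
  moreover have "shift (along (X P24)) Q = [:Q, 0:]" "shift (along (X P24)) v2 = [:v2, 0:]"
    by (simp_all add: Q_def)
  ultimately show "\<exists>r\<in>ideal.span {v2, Q, P}. shift (along (X P24)) s = [:s, r:]"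
    by blast
qed (simp add: m_def)

text \<open>First \<open>k1\<close> is regular modulo the enlarged ideal: shifting \<open>v4\<close>
  adds \<open>2 * m\<close>, shifting \<open>\<beta>2\<close> adds \<open>- (v1 * \<xi>2)\<close>.
  The direction \<open>\<beta>1\<close> would not help modulo \<open>\<xi>1\<close>. Then the
  members are exchanged.\<close>

lemma nzd_mod_k1: "nzd v2 (ideal.span {k1, Q, P})" "nzd \<xi>1 (ideal.span {k1, Q, P})"
proof -
  have "nzd k1 (ideal.span {v2, Q, P})"
    using nzd_mult[OF nzd_2 nzd_m]
    by (rule nzd_shift[where e = "along (Z T123)"])
      (simp_all add: m_def PQ_defs k_defs algebra_simps)
  then show "nzd v2 (ideal.span {k1, Q, P})"
    using nzd_mod_PQ(2) by (rule nzd_swap)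
  have "nzd (- (v1 * \<xi>2)) (ideal.span {\<xi>1, Q, P})"
    using nzd_mod_PQ(4,5) by (intro nzd_uminus nzd_mult) (simp_all add: insert_commute)
  then have "nzd k1 (ideal.span {\<xi>1, Q, P})"
    by (rule nzd_shift[where e = "along (Y P13)"]) (simp_all add: PQ_defs k_defs algebra_simps)
  then show "nzd \<xi>1 (ideal.span {k1, Q, P})"
    using nzd_mod_PQ(3) by (rule nzd_swap)
qed

lemma nzd_F4: "nzd F4 (ideal.span {k1, Q, P})"
proof -
  \<comment> \<open>Both substitutions preserve \<open>\<sigma>\<close> and hence \<open>k1\<close>:
    the first adds \<open>\<xi>1 * \<eta>1\<close> to both \<xi> . \<beta> and \<eta> . \<alpha>,
    the second moves \<beta> orthogonally to \<xi>.\<close>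
  let ?e = "(\<lambda>_. 0)(X P23 := \<xi>1, Y P23 := \<eta>1)"
  let ?e' = "(\<lambda>_. 0)(Y P23 := - \<xi>3, Y P12 := \<xi>1)"
  have "nzd \<xi>\<alpha> (ideal.span {k1, Q, P})"
    using nzd_mult[OF nzd_mod_k1(2,2)]
    by (rule nzd_shift[where e = ?e]) (simp_all add: PQ_defs k_defs \<xi>\<alpha>_def algebra_simps)
  then have "nzd (2 * (v2 * \<xi>\<alpha>)) (ideal.span {k1, Q, P})"
    by (intro nzd_mult nzd_2 nzd_mod_k1)
  \<comment> \<open>The element \<open>2 * (v2 * \<xi>\<alpha> - P * \<alpha>2)\<close> is the
    \<open>T\<close>-coefficient of \<open>F4\<close> under \<open>?e'\<close>; modulo
    \<open>P\<close> only its first term remains.\<close>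
  moreover have "2 * (v2 * \<xi>\<alpha> - P * \<alpha>2) - 2 * (v2 * \<xi>\<alpha>) = (- 2 * \<alpha>2) * P"
    by (simp add: algebra_simps)
  then have "2 * (v2 * \<xi>\<alpha> - P * \<alpha>2) - 2 * (v2 * \<xi>\<alpha>) \<in> ideal.span {k1, Q, P}"
    by (metis ideal.span_scale ideal.span_base insertI1 insertI2)
  ultimately have "nzd (2 * (v2 * \<xi>\<alpha> - P * \<alpha>2)) (ideal.span {k1, Q, P})"
    by (rule nzd_cong)
  then show ?thesis
    by (rule nzd_shift[where e = ?e'])
      (simp_all add: PQ_defs k_defs F4_def \<xi>\<alpha>_def algebra_simps)
qed

section \<open>Regularity of \<open>F1\<close>, \<open>F2\<close>, \<open>F3\<close>\<close>

lemma nzd_mod_Q: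
  "nzd Q (ideal.span {})" "nzd v1 (ideal.span {Q})" "nzd \<xi>2 (ideal.span {Q})"
  "nzd \<eta>3 (ideal.span {Q})" "nzd \<eta>3 (ideal.span {Q, v1})" "nzd v2 (ideal.span {Q, v1})"
  "nzd \<eta>3 (ideal.span {Q, \<xi>2})" "nzd v1 (ideal.span {Q, \<xi>2})"
proof -
  show "nzd Q (ideal.span {})"
    by (rule nzd_shift[where e = "along (Y P14)" and l = v1]; (rule nzd_V)?; simp add: Q_def)
  show "nzd \<xi>2 (ideal.span {Q})"
    by (rule nzd_V) (simp add: Q_def)
  show "nzd v1 (ideal.span {Q})" "nzd v1 (ideal.span {Q, \<xi>2})" "nzd \<eta>3 (ideal.span {Q, v1})"
    by (rule nzd_swap_shift[where e = "along (Y P24)" and l = v2]; (rule nzd_V)?; simp add: Q_def)+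
  show "nzd \<eta>3 (ideal.span {Q})" "nzd \<eta>3 (ideal.span {Q, \<xi>2})"
    by (rule nzd_swap_shift[where e = "along (Y P14)" and l = v1]; (rule nzd_V)?; simp add: Q_def)+
  show "nzd v2 (ideal.span {Q, v1})"
    by (rule nzd_swap_shift[where e = "along (Y P34)" and l = v3]; (rule nzd_V)?; simp add: Q_def)
qed

text \<open>Twice this element is the amount by which \<open>F3\<close> moves in
  \<open>nzd_F3\<close>. The variable \<open>v3\<close> cancels in it.\<close>

definition "w = \<eta>3 * P - \<xi>3 * Q"

lemma shift_w:
  assumes "\<forall>v. v \<noteq> X P14 \<and> v \<noteq> X P24 \<longrightarrow> e v = 0"
  shows "shift e w = [:w, \<eta>3 * (e (X P14) * v1 + e (X P24) * v2):]"
  using assms by (simp add: w_def PQ_defs algebra_simps)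

lemma nzd_mod_w:
  "nzd w (ideal.span {})" "nzd v1 (ideal.span {w})" "nzd \<xi>2 (ideal.span {w})"
  "nzd \<xi>3 (ideal.span {w})" "nzd Q (ideal.span {w})" "nzd v1 (ideal.span {w, \<xi>3})"
  "nzd \<xi>2 (ideal.span {w, \<xi>3})" "nzd v1 (ideal.span {w, Q})" "nzd \<xi>2 (ideal.span {w, Q})"
proof -
  note [simp] = nzd_mod_Q insert_commute[of _ Q]
  show "nzd w (ideal.span {})"
    by (rule nzd_shift[where e = "along (X P14)" and l = "\<eta>3 * v1"];
        (rule nzd_mult; (rule nzd_V)?)?; simp add: shift_w)
  show "nzd v1 (ideal.span {w})" "nzd v1 (ideal.span {w, \<xi>3})"
    by (rule nzd_swap_shift[where e = "along (X P24)" and l = "\<eta>3 * v2"];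
        (rule nzd_mult)?; (rule nzd_V)?; simp add: shift_w)+
  show "nzd \<xi>2 (ideal.span {w})" "nzd \<xi>3 (ideal.span {w})" "nzd \<xi>2 (ideal.span {w, \<xi>3})"
    by (rule nzd_swap_shift[where e = "along (X P14)" and l = "\<eta>3 * v1"];
        (rule nzd_mult)?; (rule nzd_V)?; simp add: shift_w)+
  show "nzd Q (ideal.span {w})" "nzd \<xi>2 (ideal.span {w, Q})"
    by (rule nzd_swap_shift[where e = "along (X P14)" and l = "\<eta>3 * v1"];
        (rule nzd_mult nzd_mod_Q)?; (simp add: shift_w; fail)?; simp add: Q_def)+
  show "nzd v1 (ideal.span {w, Q})"
    by (rule nzd_swap_shift[where e = "along (X P24)" and l = "\<eta>3 * v2"];
        (rule nzd_mult nzd_mod_Q)?; (simp add: shift_w; fail)?; simp add: Q_def)+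
qed

text \<open>Only \<open>\<sigma>\<close> brings \<open>\<beta>2\<close> into \<open>F1\<close>, so
  shifting \<open>\<beta>2\<close> adds \<open>- (v1 * \<xi>2)\<close>, a product of
  variables.\<close>

lemma nzd_mod_F1:
  "nzd F1 (ideal.span {})" "nzd \<xi>3 (ideal.span {F1})" "nzd Q (ideal.span {F1})"
  "nzd w (ideal.span {F1})" "nzd \<xi>3 (ideal.span {F1, w})" "nzd Q (ideal.span {F1, w})"
proof -
  let ?e = "along (Y P13)"
  have F1: "shift ?e F1 = [:F1, - (v1 * \<xi>2):]"
    by (simp add: F1_def PQ_defs k_defs algebra_simps)
  have l: "nzd (- (v1 * \<xi>2)) (ideal.span S)"
    if "nzd v1 (ideal.span S)" "nzd \<xi>2 (ideal.span S)" for S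
    using that by (intro nzd_uminus nzd_mult)
  note F1_swap = nzd_swap_shift[OF l _ F1]
  note [simp] = nzd_mod_Q nzd_mod_w insert_commute[of _ w]
  show "nzd F1 (ideal.span {})"
    by (rule nzd_shift[OF l F1]; (rule nzd_V)?; simp)
  show "nzd \<xi>3 (ideal.span {F1})"
    by (rule F1_swap; (rule nzd_V)?; simp)
  show "nzd Q (ideal.span {F1})" "nzd w (ideal.span {F1})" "nzd \<xi>3 (ideal.span {F1, w})"
    "nzd Q (ideal.span {F1, w})"
    by (rule F1_swap; (rule nzd_mod_Q nzd_mod_w | simp; fail)?;
        simp add: w_def PQ_defs algebra_simps)+
qed

text \<open>The substitution adds \<open>\<xi>3 * \<eta>2\<close> to both \<xi> . \<beta> and \<eta>
  . \<alpha>. Thus \<open>\<sigma>\<close>, and with it \<open>F1\<close>, stays fixed while the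
  term \<open>2 * \<alpha>2 * Q\<close> of \<open>F2\<close> moves.\<close>

lemma nzd_F2: "nzd F2 (ideal.span {F1})"
  and nzd_w_mod_F: "nzd w (ideal.span {F2, F1})"
proof -
  let ?e = "(\<lambda>_. 0)(X P13 := \<xi>3, Y P12 := \<eta>2)"
  have F2: "shift ?e F2 = [:F2, - (2 * (\<xi>3 * Q)):]"
    by (simp add: F2_def PQ_defs k_defs algebra_simps)
  have l: "nzd (- (2 * (\<xi>3 * Q))) (ideal.span S)"
    if "nzd \<xi>3 (ideal.span S)" "nzd Q (ideal.span S)" for S
    using that by (intro nzd_uminus nzd_mult nzd_2)
  have fixed: "shift ?e F1 = [:F1:]" "shift ?e w = [:w:]"
    by (simp_all add: w_def F1_def PQ_defs k_defs algebra_simps)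
  show "nzd F2 (ideal.span {F1})"
    by (rule nzd_shift[OF l F2]) (simp_all add: nzd_mod_F1 fixed)
  show "nzd w (ideal.span {F2, F1})"
    by (rule nzd_swap_shift[OF l _ F2]) (simp_all add: nzd_mod_F1 fixed insert_commute[of w])
qed

text \<open>Again \<open>\<sigma>\<close> is fixed, and \<open>F3\<close> moves through its
  coefficients \<open>\<beta>3\<close> and \<open>\<alpha>3\<close> by \<open>2 * w\<close>.\<close>

lemma nzd_F3: "nzd F3 (ideal.span {F2, F1})"
  using nzd_mult[OF nzd_2 nzd_w_mod_F]
  by (rule nzd_shift[where e = "(\<lambda>_. 0)(X P12 := \<xi>3, Y P12 := \<eta>3)"])
    (simp_all add: w_def F_defs PQ_defs k_defs algebra_simps)

section \<open>The determinantal ideal\<close>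

definition "G2 = \<xi>2 * v2 + \<xi>3 * v3"
definition "G3 = \<eta>2 * v2 + \<eta>3 * v3"
lemmas G_defs = G2_def G3_def

lemma nzd_v:
  "nzd v1 (ideal.span {})" "nzd v2 (ideal.span {v1})" "nzd v3 (ideal.span {v2, v1})"
  by (rule nzd_V; simp)+

lemma nzd_m_mod_v: "nzd m (ideal.span {v1, v2, v3})"
  by (rule nzd_shift[where e = "along (X P24)" and l = \<eta>3]; (rule nzd_V)?; simp add: m_def)

lemma nzd_k1_mod_v: "nzd k1 (ideal.span {v1, v2, v3})"
  using nzd_mult[OF nzd_2 nzd_m_mod_v]
  by (rule nzd_shift[where e = "along (Z T123)"]) (simp_all add: m_def k_defs algebra_simps)

lemma nzd_G2: "nzd G2 (ideal.span {v1})"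
  by (rule nzd_shift[where e = "along (X P24)" and l = v2]; (rule nzd_V)?; simp add: G2_def)

lemma nzd_G3: "nzd G3 (ideal.span {G2, v1})"
proof (rule nzd_shift[where e = "along (Y P24)" and l = v2])
  show "nzd v2 (ideal.span {G2, v1})"
    by (rule nzd_swap_shift[where e = "along (X P34)" and l = v3]; (rule nzd_V)?; simp add: G2_def)
qed (simp_all add: G_defs)

text \<open>Here \<open>m\<close>, \<open>G2\<close>, \<open>G3\<close> are the minors of the matrix
  with columns (\<xi>2, \<xi>3), (\<eta>2, \<eta>3), (-v3, v2). An expression for
  \<open>v2 * r\<close> is cleared of \<open>m\<close>, then reduced modulo \<open>v1\<close> and
  \<open>v2\<close> to a Koszul relation between \<open>\<xi>3\<close> and
  \<open>\<eta>3\<close>.\<close>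

lemma nzd_v2: "nzd v2 (ideal.span {v1, m, G2, G3})"
  unfolding nzd_def
proof (intro allI impI)
  let ?I = "ideal.span {v1, m, G2, G3}"
  fix r assume "v2 * r \<in> ?I"
  then obtain A s0 where "s0 \<in> ideal.span {m, G2, G3}" and s0: "v2 * r = A * v1 + s0"
    unfolding span_insert_iff[of _ v1] by blast
  then obtain C s where s: "s \<in> ideal.span {G2, G3}" and r: "v2 * r = A * v1 + (C * m + s)"
    unfolding span_insert_iff[of _ m] by blast
  obtain B2 B3 where s': "s = B2 * G2 + B3 * G3"
    using s by (auto simp: span2_iff)
  have "m * C = (- A) * v1 + (r - B2 * \<xi>2 - B3 * \<eta>2) * v2 + (- B2 * \<xi>3 - B3 * \<eta>3) * v3"
    using r by (simp add: s' G_defs algebra_simps)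
  then have "C \<in> ideal.span {v1, v2, v3}"
    using nzd_m_mod_v by (metis nzdD span3_iff)
  then obtain C1 C2 C3 where C: "C = C1 * v1 + C2 * v2 + C3 * v3"
    by (auto simp: span3_iff)
  \<comment> \<open>Cramer's rule writes \<open>m * v2\<close> and \<open>m * v3\<close> through
    \<open>G2\<close> and \<open>G3\<close>, which absorbs \<open>C * m\<close> into the other
    terms.\<close>
  define A' B2' B3' where "A' = A + C1 * m" and "B2' = B2 + C2 * \<eta>3 - C3 * \<eta>2"
    and "B3' = B3 - C2 * \<xi>3 + C3 * \<xi>2"
  have r': "v2 * r = A' * v1 + B2' * G2 + B3' * G3"
    unfolding r s' C A'_def B2'_def B3'_def by (simp add: G_defs m_def algebra_simps)
  have "v3 * (B2' * \<xi>3 + B3' * \<eta>3) = (r - B2' * \<xi>2 - B3' * \<eta>2) * v2 + (- A') * v1"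
    using r' by (simp add: G_defs algebra_simps)
  then have "B2' * \<xi>3 + B3' * \<eta>3 \<in> ideal.span {v2, v1}"
    using nzd_v(3) by (metis nzdD span2_iff)
  then obtain c d where cd: "B2' * \<xi>3 + B3' * \<eta>3 = c * v2 + d * v1"
    by (auto simp: span2_iff)
  have "\<eta>3 * B3' = (- B2') * \<xi>3 + c * v2 + d * v1"
    using cd by (simp add: algebra_simps)
  moreover have "nzd \<eta>3 (ideal.span {\<xi>3, v2, v1})"
    by (rule nzd_V) simp
  ultimately have "B3' \<in> ideal.span {\<xi>3, v2, v1}"
    by (metis nzdD span3_iff)
  then obtain E p2 p1 where B3': "B3' = E * \<xi>3 + p2 * v2 + p1 * v1"
    by (auto simp: span3_iff)
  have "\<xi>3 * (B2' + E * \<eta>3) = (c - p2 * \<eta>3) * v2 + (d - p1 * \<eta>3) * v1"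
    using cd by (simp add: B3' algebra_simps)
  moreover have "nzd \<xi>3 (ideal.span {v2, v1})"
    by (rule nzd_V) simp
  ultimately have "B2' + E * \<eta>3 \<in> ideal.span {v2, v1}"
    by (metis nzdD span2_iff)
  then obtain q2 q1 where "B2' + E * \<eta>3 = q2 * v2 + q1 * v1"
    by (auto simp: span2_iff)
  then have B2': "B2' = q2 * v2 + q1 * v1 - E * \<eta>3"
    by (simp add: algebra_simps)
  \<comment> \<open>The Koszul part contributes \<open>- E * (\<eta>3 * G2 - \<xi>3 * G3)\<close>,
    which is \<open>- E * m * v2\<close>; hence the term with \<open>m\<close>.\<close>
  let ?s = "(- E) * m + (q2 * G2 + p2 * G3)"
  have "v2 * (r - ?s) = (A' * v1 + B2' * G2 + B3' * G3) - v2 * ?s"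
    by (simp only: right_diff_distrib r')
  also have "\<dots> = (A' + q1 * G2 + p1 * G3) * v1"
    by (simp add: B2' B3' G_defs m_def algebra_simps)
  finally have "r - ?s \<in> ideal.span {v1}"
    using nzd_v(2) by (metis nzdD span1_iff)
  then have "r - ?s \<in> ?I"
    by (rule subsetD[OF ideal.span_mono, rotated]) simp
  moreover have "?s \<in> ?I"
    by (intro ideal.span_add ideal.span_scale ideal.span_base) auto
  ultimately show "r \<in> ?I"
    using ideal.span_add by fastforce
qed

lemma aug_add: "r \<in> aug \<Longrightarrow> s \<in> aug \<Longrightarrow> r + s \<in> aug"
  and aug_diff: "r \<in> aug \<Longrightarrow> s \<in> aug \<Longrightarrow> r - s \<in> aug"
  and aug_mult: "s \<in> aug \<Longrightarrow> r * s \<in> aug"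
  using subspace_aug ideal.subspace_add ideal.subspace_diff ideal.subspace_scale by blast+

lemmas aug_intros = aug_add aug_diff aug_mult V_aug t_aug

lemma one_notin_span: "S \<subseteq> aug \<Longrightarrow> 1 \<notin> ideal.span S"
  using ideal.span_minimal[OF _ subspace_aug] one_aug by blast

lemma k1_F: "k1 = F1 - 2 * \<beta>1 * P + 2 * \<alpha>1 * Q"
  and k2_F: "k2 = F2 - 2 * \<beta>2 * P + 2 * \<alpha>2 * Q"
  and k3_F: "k3 = F3 - 2 * \<beta>3 * P + 2 * \<alpha>3 * Q"
  by (simp_all add: F_defs)

lemma gens_aug:
  "{F1, F2, F3, F4, D} \<subseteq> aug" "{P, Q, k1, k2, k3} \<subseteq> aug" "{v1, m, G2, G3} \<subseteq> aug"
  "{v1, v2, v3} \<subseteq> aug"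
proof -
  have "P \<in> aug" "Q \<in> aug" "\<xi>\<alpha> \<in> aug" "\<xi>\<beta> \<in> aug" "\<eta>\<alpha> \<in> aug" "\<eta>\<beta> \<in> aug"
    unfolding PQ_defs \<xi>\<alpha>_def \<xi>\<beta>_def \<eta>\<alpha>_def \<eta>\<beta>_def by (intro aug_intros)+
  moreover from this have "\<sigma> \<in> aug"
    unfolding \<sigma>_def by (intro aug_intros)
  moreover from this have k: "k1 \<in> aug" "k2 \<in> aug" "k3 \<in> aug"
    unfolding k1_def k2_def k3_def by (intro aug_intros)+
  ultimately show "{F1, F2, F3, F4, D} \<subseteq> aug" "{P, Q, k1, k2, k3} \<subseteq> aug"
    unfolding F_defs D_def power2_eq_square by (auto intro!: aug_intros)
  show "{v1, m, G2, G3} \<subseteq> aug" "{v1, v2, v3} \<subseteq> aug"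
    unfolding m_def G_defs by (auto intro!: aug_intros)
qed

subsection \<open>The three links\<close>

text \<open>The link is through \<open>v1\<close>, \<open>G2\<close>, \<open>G3\<close>, with test
  elements \<open>m\<close> and \<open>v2\<close>; Cramer's rule supplies the products.\<close>

lemma linked_determinantal_vars:
  "directly_linked (ideal.span {v1, m, G2, G3}) (ideal.span {v1, v2, v3})"
proof (rule directly_linkedI)
  let ?L = "{v1, G2, G3}"
  show "regular_sequence [v1, G2, G3]"
    using gens_aug(3) by (intro regular_sequence3 nzd_v nzd_G2 nzd_G3 one_notin_span) auto
  show "?L = set [v1, G2, G3]" by simp
  show "1 \<notin> ideal.span {v1, m, G2, G3}" "1 \<notin> ideal.span {v1, v2, v3}"
    by (intro one_notin_span gens_aug)+
  show "?L \<subseteq> ideal.span {v1, m, G2, G3}"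
    by (auto intro: ideal.span_base)
  show L_v: "?L \<subseteq> ideal.span {v1, v2, v3}"
    unfolding G_defs by (auto intro!: ideal.span_add ideal.span_scale intro: ideal.span_base)
  have m: "m * v2 = \<eta>3 * G2 + (- \<xi>3) * G3 + 0 * v1" "m * v3 = \<xi>2 * G3 + (- \<eta>2) * G2 + 0 * v1"
    by (simp_all add: m_def G_defs algebra_simps)
  have "m * v2 \<in> ideal.span ?L" "m * v3 \<in> ideal.span ?L"
    by (rule m[THEN span_mult_eq]; simp)+
  moreover have "b * v1 \<in> ideal.span ?L" for b
    using span_mult_left[of v1 ?L b] by (simp add: mult.commute)
  ultimately show "a * b \<in> ideal.span ?L" if "a \<in> {v1, m, G2, G3}" "b \<in> {v1, v2, v3}" for a b
    using that by (auto intro: span_mult_left)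
  show "r \<in> ideal.span {v1, v2, v3}" if "m * r \<in> ideal.span ?L" for r
    using nzdD[OF nzd_m_mod_v] that L_v by (meson span_subset_iff subsetD)
  have "ideal.span ?L \<subseteq> ideal.span {v1, m, G2, G3}"
    by (rule ideal.span_mono) auto
  then show "r \<in> ideal.span {v1, m, G2, G3}" if "v2 * r \<in> ideal.span ?L" for r
    using nzdD[OF nzd_v2] that by blast
qed simp_all

text \<open>Shifting \<open>\<beta>1\<close> moves \<open>k2\<close>, through
  \<open>\<sigma>\<close>, by \<open>T\<close> times \<open>- (v2 * \<xi>1)\<close>.\<close>

lemma nzd_k2: "nzd k2 (ideal.span {v1, m, G2, G3})"
proof -
  have "nzd \<xi>1 (ideal.span {v1, m, G2, G3})"
    by (rule nzd_V) (simp add: m_def G_defs)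
  from nzd_uminus[OF nzd_mult[OF nzd_v2 this]] show ?thesis
    by (rule nzd_shift[where e = "along (Y P23)"])
      (simp_all add: m_def G_defs k_defs algebra_simps)
qed

lemma v1_k2: "v1 * k2 = v2 * k1 + 2 * v4 * \<xi>3 * Q + - (2 * v4 * \<eta>3) * P"
  and v1_k3: "v1 * k3 = v3 * k1 + 2 * v4 * \<eta>2 * P + - (2 * v4 * \<xi>2) * Q"
  by (simp_all add: k2_def k1_def k3_def PQ_defs algebra_simps)

text \<open>Together with \<open>cross_colon_v1\<close> this describes the five-generator ideal as
  the colon of \<open>P\<close>, \<open>Q\<close>, \<open>k1\<close> by \<open>v1\<close>, so that
  questions about it can be moved to a regular sequence.\<close>

lemma v1_mult_cross:
  assumes "a \<in> ideal.span {P, Q, k1, k2, k3}"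
  shows "v1 * a \<in> ideal.span {P, Q, k1}"
proof (rule span_mult_subset[OF _ ideal.span_base[of v1 "{v1}"] assms])
  have "v1 * k2 \<in> ideal.span {P, Q, k1}" "v1 * k3 \<in> ideal.span {P, Q, k1}"
    by (rule v1_k2[THEN span_mult_eq] v1_k3[THEN span_mult_eq]; simp)+
  then show "b * a \<in> ideal.span {P, Q, k1}" if "b \<in> {v1}" "a \<in> {P, Q, k1, k2, k3}" for a b
    using that by (auto intro: ideal.span_scale ideal.span_base)
qed simp

lemma cross_colon_v1:
  assumes "v1 * r \<in> ideal.span {P, Q, k1}"
  shows "r \<in> ideal.span {P, Q, k1, k2, k3}"
  using k1_def k2_def k3_def P_def Q_def _ nzd_k1_mod_v assms
  by (rule cross_colon) (use nzd_mod_PQ(1) in \<open>simp add: insert_commute\<close>)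

text \<open>The link is through \<open>P\<close>, \<open>Q\<close>, \<open>k1\<close>. The test
  element \<open>k2\<close> is regular modulo the determinantal ideal; for \<open>v1\<close> the
  colon is already known.\<close>

lemma linked_cross_determinantal:
  "directly_linked (ideal.span {P, Q, k1, k2, k3}) (ideal.span {v1, m, G2, G3})"
proof (rule directly_linkedI)
  let ?L = "{P, Q, k1}" and ?I = "{v1, m, G2, G3}"
  show "regular_sequence [P, Q, k1]"
    using gens_aug(2) by (intro regular_sequence3 nzd_P nzd_Q nzd_k1 one_notin_span) auto
  show "?L = set [P, Q, k1]" by simp
  show "1 \<notin> ideal.span {P, Q, k1, k2, k3}" "1 \<notin> ideal.span ?I"
    by (intro one_notin_span gens_aug)+
  show "?L \<subseteq> ideal.span {P, Q, k1, k2, k3}"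
    by (auto intro: ideal.span_base)
  have "P = \<xi>1 * v1 + G2" "Q = \<eta>1 * v1 + G3" "k1 = 2 * v4 * m - \<sigma> * v1"
    by (simp_all add: PQ_defs G_defs k1_def m_def)
  then have "P \<in> ideal.span ?I" "Q \<in> ideal.span ?I" "k1 \<in> ideal.span ?I"
    by (auto intro!: ideal.span_add ideal.span_diff ideal.span_scale intro: ideal.span_base)
  then show sub: "?L \<subseteq> ideal.span ?I"
    by simp
  have v1_k: "v1 * k \<in> ideal.span ?L" if "k \<in> {k1, k2, k3}" for k
    using that by (intro v1_mult_cross ideal.span_base) auto
  \<comment> \<open>With \<open>m\<close> the first coordinate of \<xi> x \<eta>, these come from
    (\<xi> x \<eta>) x v = P \<eta> - Q \<xi>.\<close>
  have m_k: "m * k2 = (\<xi>3 * \<eta>1 - \<xi>1 * \<eta>3) * k1 + (- (\<sigma> * \<eta>3)) * P + (\<sigma> * \<xi>3) * Q"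
    "m * k3 = (\<xi>1 * \<eta>2 - \<xi>2 * \<eta>1) * k1 + (\<sigma> * \<eta>2) * P + (- (\<sigma> * \<xi>2)) * Q"
    unfolding k1_def k2_def k3_def m_def PQ_defs by (simp_all add: algebra_simps)
  have "m * k2 \<in> ideal.span ?L" "m * k3 \<in> ideal.span ?L"
    by (rule m_k[THEN span_mult_eq]; simp)+
  moreover have "G2 * k = k * P - \<xi>1 * (v1 * k)" "G3 * k = k * Q - \<eta>1 * (v1 * k)" for k
    by (simp_all add: PQ_defs G_defs algebra_simps)
  then have "G2 * k \<in> ideal.span ?L" "G3 * k \<in> ideal.span ?L" if "k \<in> {k1, k2, k3}" for k
    using v1_k[OF that] by (auto intro!: ideal.span_diff ideal.span_scale intro: ideal.span_base)
  ultimately have "b * a \<in> ideal.span ?L" if "a \<in> {k2, k3}" "b \<in> ?I" for a b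
    using that v1_k by auto
  then show "a * b \<in> ideal.span ?L" if "a \<in> {P, Q, k1, k2, k3}" "b \<in> ?I" for a b
    using that span_mult_left[of a ?L b] by (cases "a \<in> ?L") (auto simp: mult.commute)
  show "r \<in> ideal.span ?I" if "k2 * r \<in> ideal.span ?L" for r
    using nzdD[OF nzd_k2] that sub by (meson span_subset_iff subsetD)
  show "r \<in> ideal.span {P, Q, k1, k2, k3}" if "v1 * r \<in> ideal.span ?L" for r
    using that by (rule cross_colon_v1)
qed simp_all

section \<open>The Pfaffian ideal of \<xi>, \<alpha>, v, v4\<close>

definition "p1 = \<alpha>2 * v3 - \<alpha>3 * v2 + v4 * \<xi>1"
definition "p2 = \<alpha>3 * v1 - \<alpha>1 * v3 + v4 * \<xi>2"
definition "p3 = \<alpha>1 * v2 - \<alpha>2 * v1 + v4 * \<xi>3"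
lemmas p_defs = p1_def p2_def p3_def

text \<open>The vector p = \<alpha> x v + v4 \<xi> has the shape of k, with \<alpha> and v as
  factors, \<xi> in place of v and \<open>- v4\<close> in place of \<open>\<sigma>\<close>. This
  makes \<open>cross_syzygy\<close> and \<open>cross_colon\<close> applicable.\<close>

lemma p_cross:
  "p1 = 1 * (\<alpha>2 * v3 - \<alpha>3 * v2) - (- v4) * \<xi>1"
  "p2 = 1 * (\<alpha>3 * v1 - \<alpha>1 * v3) - (- v4) * \<xi>2" "p3 = 1 * (\<alpha>1 * v2 - \<alpha>2 * v1) - (- v4) * \<xi>3"
  "\<xi>\<alpha> = \<alpha>1 * \<xi>1 + \<alpha>2 * \<xi>2 + \<alpha>3 * \<xi>3" "P = v1 * \<xi>1 + v2 * \<xi>2 + v3 * \<xi>3"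
  by (simp_all add: p_defs P_def \<xi>\<alpha>_def mult.commute)

lemma nzd_mod_\<xi>\<alpha>:
  "nzd \<xi>\<alpha> (ideal.span {})" "nzd \<xi>1 (ideal.span {\<xi>\<alpha>})" "nzd \<xi>2 (ideal.span {\<xi>\<alpha>})"
  "nzd \<xi>2 (ideal.span {\<xi>\<alpha>, \<xi>1})" "nzd \<xi>1 (ideal.span {\<xi>\<alpha>, \<xi>2})"
  "nzd \<xi>3 (ideal.span {\<xi>\<alpha>, \<alpha>3, \<xi>2})" "nzd \<alpha>3 (ideal.span {\<xi>\<alpha>, \<xi>2})"
proof -
  show "nzd \<xi>\<alpha> (ideal.span {})"
    by (rule nzd_shift[where e = "along (X P23)" and l = \<xi>1]; (rule nzd_V)?; simp add: \<xi>\<alpha>_def)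
  show "nzd \<xi>1 (ideal.span {\<xi>\<alpha>})"
    by (rule nzd_swap_shift[where e = "along (X P13)" and l = \<xi>2]; (rule nzd_V)?;
        simp add: \<xi>\<alpha>_def)
  show "nzd \<xi>2 (ideal.span {\<xi>\<alpha>})" "nzd \<xi>3 (ideal.span {\<xi>\<alpha>, \<alpha>3, \<xi>2})"
    "nzd \<alpha>3 (ideal.span {\<xi>\<alpha>, \<xi>2})"
    by (rule nzd_swap_shift[where e = "along (X P23)" and l = \<xi>1]; (rule nzd_V)?;
        simp add: \<xi>\<alpha>_def)+
  show "nzd \<xi>2 (ideal.span {\<xi>\<alpha>, \<xi>1})" "nzd \<xi>1 (ideal.span {\<xi>\<alpha>, \<xi>2})"
    by (rule nzd_swap_shift[where e = "along (X P12)" and l = \<xi>3]; (rule nzd_V)?;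
        simp add: \<xi>\<alpha>_def)+
qed

lemma nzd_P_mod_\<xi>\<alpha>: "nzd P (ideal.span {\<xi>\<alpha>})"
  by (rule nzd_shift[OF nzd_mod_\<xi>\<alpha>(2), where e = "along (Z T234)"]) (simp_all add: P_def \<xi>\<alpha>_def)

lemma nzd_mod_P_\<xi>\<alpha>:
  "nzd \<xi>1 (ideal.span {P, \<xi>\<alpha>})" "nzd \<xi>2 (ideal.span {P, \<xi>\<alpha>})"
  "nzd \<alpha>3 (ideal.span {P, \<xi>2, \<xi>\<alpha>})"
proof -
  note [simp] = nzd_mod_\<xi>\<alpha> insert_commute[of _ \<xi>\<alpha>]
  show "nzd \<xi>1 (ideal.span {P, \<xi>\<alpha>})"
    by (rule nzd_swap_shift[where e = "along (Z T134)" and l = \<xi>2]; (simp; fail)?;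
        simp add: P_def \<xi>\<alpha>_def)
  show "nzd \<xi>2 (ideal.span {P, \<xi>\<alpha>})"
    by (rule nzd_swap_shift[where e = "along (Z T234)" and l = \<xi>1]; (simp; fail)?;
        simp add: P_def \<xi>\<alpha>_def)
  show "nzd \<alpha>3 (ideal.span {P, \<xi>2, \<xi>\<alpha>})"
    by (rule nzd_swap_shift[where e = "along (Z T124)" and l = \<xi>3]; (simp; fail)?;
        simp add: P_def \<xi>\<alpha>_def)
qed

lemma nzd_p1: "nzd p1 (ideal.span {P, \<xi>\<alpha>})"
  by (rule nzd_shift[OF nzd_mod_P_\<xi>\<alpha>(1), where e = "along (Z T123)"])
    (simp_all add: p1_def P_def \<xi>\<alpha>_def)

lemma nzd_p1_mod_\<xi>: "nzd p1 (ideal.span {\<xi>1, \<xi>2, \<xi>3})"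
  by (rule nzd_shift[where e = "along (X P13)" and l = v3]; (rule nzd_V)?; simp add: p1_def)

text \<open>With \<open>\<xi>2\<close> among the generators, shifting \<open>v2\<close> moves
  \<open>P\<close> only inside the ideal and adds \<open>- \<alpha>3\<close> to \<open>p1\<close>;
  then \<open>\<xi>2\<close> and \<open>p1\<close> are exchanged.\<close>

lemma nzd_\<xi>2_mod_p1: "nzd \<xi>2 (ideal.span {p1, P, \<xi>\<alpha>})"
proof (rule nzd_swap[OF nzd_shift' nzd_mod_P_\<xi>\<alpha>(2)])
  let ?S = "{\<xi>2, P, \<xi>\<alpha>}"
  show "nzd (- \<alpha>3) (ideal.span ?S)"
    using nzd_uminus[OF nzd_mod_P_\<xi>\<alpha>(3)] by (simp add: insert_commute)
  fix s assume "s \<in> ?S"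
  moreover have "\<xi>2 \<in> ideal.span ?S" "0 \<in> ideal.span ?S"
    by (simp_all add: ideal.span_base ideal.span_zero)
  moreover have "shift (along (Z T134)) P = [:P, \<xi>2:]" "shift (along (Z T134)) \<xi>2 = [:\<xi>2, 0:]"
    "shift (along (Z T134)) \<xi>\<alpha> = [:\<xi>\<alpha>, 0:]"
    by (simp_all add: P_def \<xi>\<alpha>_def)
  ultimately show "\<exists>r\<in>ideal.span ?S. shift (along (Z T134)) s = [:s, r:]"
    by blast
qed (simp add: p1_def)

text \<open>Replacing \<open>t\<close> by \<open>- t\<close> here gives
  \<open>2 * \<xi>\<beta> - \<sigma>\<close>.\<close>

definition "\<tau> = t + \<xi>\<beta> + \<eta>\<alpha>"

text \<open>Multiplication by \<open>\<xi>1\<close> moves the question to the regular sequence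
  \<open>\<xi>\<alpha>\<close>, \<open>P\<close>, \<open>p1\<close>, where shifting
  \<open>\<beta>2\<close> adds \<open>\<xi>2\<close> to \<open>\<tau>\<close>;
  \<open>cross_colon\<close> then removes \<open>\<xi>1\<close>.\<close>

lemma nzd_\<tau>: "nzd \<tau> (ideal.span {\<xi>\<alpha>, P, p1, p2, p3})"
  unfolding nzd_def
proof (intro allI impI)
  let ?L = "{\<xi>\<alpha>, P, p1}" and ?I = "{\<xi>\<alpha>, P, p1, p2, p3}"
  fix r assume \<tau>: "\<tau> * r \<in> ideal.span ?I"
  have p: "\<xi>1 * p2 = \<xi>2 * p1 + \<alpha>3 * P + (- v3) * \<xi>\<alpha>"
    "\<xi>1 * p3 = \<xi>3 * p1 + v2 * \<xi>\<alpha> + (- \<alpha>2) * P"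
    by (simp_all add: p_defs P_def \<xi>\<alpha>_def algebra_simps)
  have "\<xi>1 * p2 \<in> ideal.span ?L" "\<xi>1 * p3 \<in> ideal.span ?L"
    by (rule p[THEN span_mult_eq]; simp)+
  then have prod: "a * b \<in> ideal.span ?L" if "a \<in> {\<xi>1}" "b \<in> ?I" for a b
    using that by (auto intro: ideal.span_scale ideal.span_base)
  have "\<xi>1 * (\<tau> * r) \<in> ideal.span ?L"
    by (rule span_mult_subset[OF prod ideal.span_base[of \<xi>1 "{\<xi>1}"] \<tau>]) simp_all
  then have "\<tau> * (\<xi>1 * r) \<in> ideal.span ?L"
    by (simp only: mult.left_commute)
  moreover have "nzd \<tau> (ideal.span ?L)"
  proof (rule nzd_shift[where e = "along (Y P13)" and l = \<xi>2])
    show "nzd \<xi>2 (ideal.span ?L)"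
      using nzd_\<xi>2_mod_p1 by (simp add: insert_commute)
  qed (simp_all add: \<tau>_def \<xi>\<beta>_def \<eta>\<alpha>_def p1_def P_def \<xi>\<alpha>_def algebra_simps)
  ultimately have r: "\<xi>1 * r \<in> ideal.span ?L"
    using nzdD by blast
  have "nzd \<xi>1 (ideal.span {\<xi>\<alpha>, P})"
    using nzd_mod_P_\<xi>\<alpha>(1) by (simp add: insert_commute)
  then show "r \<in> ideal.span ?I"
    using nzd_p1_mod_\<xi> r by (rule cross_colon[OF p_cross])
qed

text \<open>The relations of \<open>\<xi>\<alpha>, P, p\<close>, the submaximal Pfaffians of a generic skew
  \<open>5 \<times> 5\<close> matrix, are generated by the rows of that matrix.\<close>

lemma pfaffian_syzygy:
  assumes "C1 * \<xi>\<alpha> + C2 * P + (h1 * p1 + h2 * p2 + h3 * p3) = 0"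
  obtains A B n1 n2 n3 where
    "h1 = A * \<alpha>1 + B * v1 + (n2 * \<xi>3 - n3 * \<xi>2)"
    "h2 = A * \<alpha>2 + B * v2 + (n3 * \<xi>1 - n1 * \<xi>3)"
    "h3 = A * \<alpha>3 + B * v3 + (n1 * \<xi>2 - n2 * \<xi>1)"
    "C1 = - A * v4 + (n1 * v1 + n2 * v2 + n3 * v3)"
    "C2 = - B * v4 - (n1 * \<alpha>1 + n2 * \<alpha>2 + n3 * \<alpha>3)"
proof -
  have "nzd p1 (ideal.span {\<xi>\<alpha>, P})"
    using nzd_p1 by (simp add: insert_commute)
  moreover have "nzd \<xi>1 (ideal.span {})" "nzd \<xi>2 (ideal.span {\<xi>1})" "nzd \<xi>3 (ideal.span {\<xi>1, \<xi>2})"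
    by (rule nzd_V; simp)+
  moreover have "h1 * p1 + h2 * p2 + h3 * p3 = (- C1) * \<xi>\<alpha> + (- C2) * P"
    using assms by (simp add: algebra_simps eq_neg_iff_add_eq_0)
  then have "h1 * p1 + h2 * p2 + h3 * p3 \<in> ideal.span {\<xi>\<alpha>, P}"
    by (metis span2_iff)
  ultimately obtain A B n1 n2 n3 where h:
    "h1 = A * \<alpha>1 + B * v1 + (n2 * \<xi>3 - n3 * \<xi>2)"
    "h2 = A * \<alpha>2 + B * v2 + (n3 * \<xi>1 - n1 * \<xi>3)"
    "h3 = A * \<alpha>3 + B * v3 + (n1 * \<xi>2 - n2 * \<xi>1)"
    by (rule cross_syzygy[OF p_cross]) blast
  \<comment> \<open>Subtracting the relations found leaves one between \<open>\<xi>\<alpha>\<close>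
    and \<open>P\<close> alone, which is a Koszul relation.\<close>
  have "(C1 + A * v4 - (n1 * v1 + n2 * v2 + n3 * v3)) * \<xi>\<alpha> +
      (C2 + B * v4 + (n1 * \<alpha>1 + n2 * \<alpha>2 + n3 * \<alpha>3)) * P = 0"
    using assms by (simp add: h p_defs P_def \<xi>\<alpha>_def algebra_simps)
  then obtain E where E: "C1 + A * v4 - (n1 * v1 + n2 * v2 + n3 * v3) = E * P"
    "C2 + B * v4 + (n1 * \<alpha>1 + n2 * \<alpha>2 + n3 * \<alpha>3) = - E * \<xi>\<alpha>"
    using koszul2[OF nzd_mod_\<xi>\<alpha>(1) nzd_P_mod_\<xi>\<alpha>] by blast
  have C: "C1 = E * P - A * v4 + (n1 * v1 + n2 * v2 + n3 * v3)"
    "C2 = - E * \<xi>\<alpha> - B * v4 - (n1 * \<alpha>1 + n2 * \<alpha>2 + n3 * \<alpha>3)"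
    using E by (simp_all add: algebra_simps)
  \<comment> \<open>Adding E \<xi> to n leaves n x \<xi> unchanged and absorbs the terms with
    \<open>E\<close> into n . v and n . \<alpha>.\<close>
  show ?thesis
    by (rule that[of A B "n2 + E * \<xi>2" "n3 + E * \<xi>3" "n1 + E * \<xi>1"])
      (simp_all add: h C P_def \<xi>\<alpha>_def algebra_simps)
qed

section \<open>Identities between the F, p and q\<close>

lemma F_combinations:
  "\<xi>1 * F1 + \<xi>2 * F2 + \<xi>3 * F3 = (2 * \<xi>\<beta> - \<sigma>) * P - 2 * \<xi>\<alpha> * Q"
  "\<eta>1 * F1 + \<eta>2 * F2 + \<eta>3 * F3 = 2 * \<eta>\<beta> * P - \<tau> * Q"
  by (simp_all add: F_defs k1_def k2_def k3_def PQ_defs \<sigma>_def \<tau>_def \<xi>\<alpha>_def \<xi>\<beta>_def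
      \<eta>\<alpha>_def \<eta>\<beta>_def algebra_simps)

lemma F4_P: "F4 * P = p1 * F1 + p2 * F2 + p3 * F3"
  by (simp add: F_defs k1_def k2_def k3_def PQ_defs \<sigma>_def \<xi>\<beta>_def \<eta>\<alpha>_def p_defs algebra_simps)

text \<open>The vector \<beta> x v + v4 \<eta>, which does for \<open>Q\<close> what p does for
  \<open>P\<close>.\<close>

definition "q1 = \<beta>2 * v3 - \<beta>3 * v2 + v4 * \<eta>1"
definition "q2 = \<beta>3 * v1 - \<beta>1 * v3 + v4 * \<eta>2"
definition "q3 = \<beta>1 * v2 - \<beta>2 * v1 + v4 * \<eta>3"
lemmas q_defs = q1_def q2_def q3_def

lemma F4_Q: "F4 * Q = q1 * F1 + q2 * F2 + q3 * F3"
  by (simp add: F_defs k1_def k2_def k3_def PQ_defs \<sigma>_def \<xi>\<beta>_def \<eta>\<alpha>_def q_defs algebra_simps)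

text \<open>Up to sign, \<open>D\<close> is the determinant of the matrix that expresses \<xi> . F
  and \<eta> . F by \<open>P\<close> and \<open>Q\<close> in \<open>F_combinations\<close>.\<close>

lemma D_eq: "D = \<tau> * (2 * \<xi>\<beta> - \<sigma>) - 4 * \<xi>\<alpha> * \<eta>\<beta>"
  by (simp add: D_def \<tau>_def \<sigma>_def power2_eq_square algebra_simps)

text \<open>The coordinates of v x F, needed since (w x v) . F = w . (v x F).\<close>

lemma F_cross:
  "v2 * F3 - v3 * F2 = 2 * p1 * Q - 2 * q1 * P"
  "v3 * F1 - v1 * F3 = 2 * p2 * Q - 2 * q2 * P"
  "v1 * F2 - v2 * F1 = 2 * p3 * Q - 2 * q3 * P"
  by (simp_all add: F_defs k1_def k2_def k3_def PQ_defs p_defs q_defs algebra_simps)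

text \<open>In this grouping the generators reappear as coefficients at the end of
  \<open>colon_P\<close>; \<open>p_q_F\<close> serves the same purpose.\<close>

lemma F_from_q:
  "F1 = v1 * (2 * \<xi>\<beta> - \<sigma>) + 2 * (\<xi>2 * q3 - \<xi>3 * q2) - 2 * \<alpha>1 * Q"
  "F2 = v2 * (2 * \<xi>\<beta> - \<sigma>) + 2 * (\<xi>3 * q1 - \<xi>1 * q3) - 2 * \<alpha>2 * Q"
  "F3 = v3 * (2 * \<xi>\<beta> - \<sigma>) + 2 * (\<xi>1 * q2 - \<xi>2 * q1) - 2 * \<alpha>3 * Q"
  "F4 = v4 * (2 * \<xi>\<beta> - \<sigma>) - 2 * (\<alpha>1 * q1 + \<alpha>2 * q2 + \<alpha>3 * q3)"
  by (simp_all add: F_defs k1_def k2_def k3_def PQ_defs q_defs \<sigma>_def \<xi>\<beta>_def \<eta>\<alpha>_def algebra_simps)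

lemma p_q_F:
  "2 * \<eta>\<beta> * p1 - \<tau> * q1 = \<beta>2 * F3 - \<beta>3 * F2 + \<eta>1 * F4"
  "2 * \<eta>\<beta> * p2 - \<tau> * q2 = \<beta>3 * F1 - \<beta>1 * F3 + \<eta>2 * F4"
  "2 * \<eta>\<beta> * p3 - \<tau> * q3 = \<beta>1 * F2 - \<beta>2 * F1 + \<eta>3 * F4"
  by (simp_all add: F_defs k1_def k2_def k3_def PQ_defs p_defs q_defs \<sigma>_def \<tau>_def \<xi>\<beta>_def
      \<eta>\<alpha>_def \<eta>\<beta>_def algebra_simps)

lemma v_q: "v1 * q1 + v2 * q2 + v3 * q3 = v4 * Q"
  by (simp add: PQ_defs q_defs algebra_simps)

text \<open>Relations are solved in three stages: those of k modulo \<open>P\<close> and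
  \<open>Q\<close>, the Koszul relation of \<open>P\<close> and \<open>Q\<close>, and the Pfaffian
  relations. Substituting back exhibits \<open>2 * r\<close> as a combination of the
  generators.\<close>

lemma colon_P:
  assumes "P * r \<in> ideal.span {F1, F2, F3}"
  shows "r \<in> ideal.span {F1, F2, F3, F4, D}"
proof -
  let ?I = "ideal.span {F1, F2, F3, F4, D}"
  obtain h1 h2 h3 where h: "P * r = h1 * F1 + h2 * F2 + h3 * F3"
    using assms by (auto simp: span3_iff)
  \<comment> \<open>Modulo \<open>P\<close> and \<open>Q\<close> the vector F is k, so h is a
    relation of k.\<close>
  have "h1 * k1 + h2 * k2 + h3 * k3 = (r - 2 * (h1 * \<beta>1 + h2 * \<beta>2 + h3 * \<beta>3)) * P
      + 2 * (h1 * \<alpha>1 + h2 * \<alpha>2 + h3 * \<alpha>3) * Q"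
    using h by (simp add: F1_def F2_def F3_def algebra_simps)
  then have "h1 * k1 + h2 * k2 + h3 * k3 \<in> ideal.span {P, Q}"
    by (metis span2_iff)
  moreover have "nzd k1 (ideal.span {P, Q})" "nzd v3 (ideal.span {v1, v2})"
    using nzd_k1 nzd_v(3) by (simp_all add: insert_commute)
  ultimately obtain A B w1 w2 w3 where hw:
    "h1 = A * \<xi>1 + B * \<eta>1 + (w2 * v3 - w3 * v2)"
    "h2 = A * \<xi>2 + B * \<eta>2 + (w3 * v1 - w1 * v3)"
    "h3 = A * \<xi>3 + B * \<eta>3 + (w1 * v2 - w2 * v1)"
    using cross_syzygy[OF k1_def k2_def k3_def P_def Q_def _ nzd_v(1,2)] by metis
  define X where "X = A * (2 * \<xi>\<beta> - \<sigma>) + 2 * B * \<eta>\<beta> - 2 * (w1 * q1 + w2 * q2 + w3 * q3)"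
  define Y where "Y = 2 * (w1 * p1 + w2 * p2 + w3 * p3) - 2 * A * \<xi>\<alpha> - B * \<tau>"
  have "P * r = A * (\<xi>1 * F1 + \<xi>2 * F2 + \<xi>3 * F3) + B * (\<eta>1 * F1 + \<eta>2 * F2 + \<eta>3 * F3)
      + (w1 * (v2 * F3 - v3 * F2) + w2 * (v3 * F1 - v1 * F3) + w3 * (v1 * F2 - v2 * F1))"
    unfolding h hw by (simp add: algebra_simps)
  also have "\<dots> = X * P + Y * Q"
    unfolding F_combinations F_cross X_def Y_def by (simp add: algebra_simps)
  finally have "(r - X) * P + (- Y) * Q = 0"
    by (simp add: algebra_simps)
  then obtain E where E: "r - X = E * Q" "- Y = - E * P"
    using koszul2[OF nzd_P nzd_Q] by blast
  \<comment> \<open>The equation \<open>Y = E * P\<close> puts \<open>\<tau> * B\<close> into the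
    Pfaffian ideal, and \<open>\<tau>\<close> cancels.\<close>
  have "\<tau> * B = (- 2 * A) * \<xi>\<alpha> + ((- E) * P + (2 * w1 * p1 + 2 * w2 * p2 + 2 * w3 * p3))"
    using E(2) by (simp add: Y_def algebra_simps)
  also have "\<dots> \<in> ideal.span {\<xi>\<alpha>, P, p1, p2, p3}"
    by (intro ideal.span_add ideal.span_scale) (auto intro: ideal.span_base)
  finally have "B \<in> ideal.span {\<xi>\<alpha>, P, p1, p2, p3}"
    using nzd_\<tau> nzdD by blast
  then obtain B0 s where "s \<in> ideal.span {P, p1, p2, p3}" and B: "B = B0 * \<xi>\<alpha> + s"
    unfolding span_insert_iff[of _ \<xi>\<alpha>] by blast
  then obtain B4 s' where "s' \<in> ideal.span {p1, p2, p3}" and s: "s = B4 * P + s'"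
    unfolding span_insert_iff[of _ P] by blast
  then obtain B1 B2 B3 where s': "s' = B1 * p1 + B2 * p2 + B3 * p3"
    by (auto simp: span3_iff)
  \<comment> \<open>Inserting the expression for \<open>B\<close> makes \<open>Y = E * P\<close> a
    relation between the five Pfaffians.\<close>
  have "(- 2 * A - \<tau> * B0) * \<xi>\<alpha> + (- E - \<tau> * B4) * P + ((2 * w1 - \<tau> * B1) * p1
      + (2 * w2 - \<tau> * B2) * p2 + (2 * w3 - \<tau> * B3) * p3) = Y - E * P"
    by (simp add: Y_def B s s' algebra_simps)
  also have "\<dots> = 0"
    using E(2) by simp
  finally obtain G H n1 n2 n3 where n:
    "2 * w1 - \<tau> * B1 = G * \<alpha>1 + H * v1 + (n2 * \<xi>3 - n3 * \<xi>2)"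
    "2 * w2 - \<tau> * B2 = G * \<alpha>2 + H * v2 + (n3 * \<xi>1 - n1 * \<xi>3)"
    "2 * w3 - \<tau> * B3 = G * \<alpha>3 + H * v3 + (n1 * \<xi>2 - n2 * \<xi>1)"
    and A: "- 2 * A - \<tau> * B0 = - G * v4 + (n1 * v1 + n2 * v2 + n3 * v3)"
    and E': "- E - \<tau> * B4 = - H * v4 - (n1 * \<alpha>1 + n2 * \<alpha>2 + n3 * \<alpha>3)"
    by (rule pfaffian_syzygy)
  have "2 * A = - (- 2 * A - \<tau> * B0) - \<tau> * B0" "E = - (- E - \<tau> * B4) - \<tau> * B4"
    by simp_all
  note eqs = n[unfolded diff_eq_eq] this[unfolded A E']
  \<comment> \<open>The Pfaffian relation determines 2 A and 2 w rather than A and w; hence the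
    factor 2, a unit. The terms with \<open>H\<close> will vanish by \<open>v_q\<close>.\<close>
  have "2 * r = (2 * A) * (2 * \<xi>\<beta> - \<sigma>) + 4 * B * \<eta>\<beta>
      - 2 * ((2 * w1) * q1 + (2 * w2) * q2 + (2 * w3) * q3) + 2 * E * Q"
  proof -
    have r: "r = X + E * Q"
      using E(1) by (simp add: diff_eq_eq add.commute)
    show ?thesis
      unfolding r X_def by (simp add: algebra_simps)
  qed
  also have "\<dots> = G * (v4 * (2 * \<xi>\<beta> - \<sigma>) - 2 * (\<alpha>1 * q1 + \<alpha>2 * q2 + \<alpha>3 * q3))
      - 2 * H * (v1 * q1 + v2 * q2 + v3 * q3 - v4 * Q)
      - n1 * (v1 * (2 * \<xi>\<beta> - \<sigma>) + 2 * (\<xi>2 * q3 - \<xi>3 * q2) - 2 * \<alpha>1 * Q)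
      - n2 * (v2 * (2 * \<xi>\<beta> - \<sigma>) + 2 * (\<xi>3 * q1 - \<xi>1 * q3) - 2 * \<alpha>2 * Q)
      - n3 * (v3 * (2 * \<xi>\<beta> - \<sigma>) + 2 * (\<xi>1 * q2 - \<xi>2 * q1) - 2 * \<alpha>3 * Q)
      - B0 * (\<tau> * (2 * \<xi>\<beta> - \<sigma>) - 4 * \<xi>\<alpha> * \<eta>\<beta>)
      + 2 * B4 * (2 * \<eta>\<beta> * P - \<tau> * Q)
      + 2 * B1 * (2 * \<eta>\<beta> * p1 - \<tau> * q1) + 2 * B2 * (2 * \<eta>\<beta> * p2 - \<tau> * q2)
      + 2 * B3 * (2 * \<eta>\<beta> * p3 - \<tau> * q3)"
    unfolding eqs B s s' by (simp add: algebra_simps)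
  also have "\<dots> = G * F4 - n1 * F1 - n2 * F2 - n3 * F3 - B0 * D
      + 2 * B4 * (\<eta>1 * F1 + \<eta>2 * F2 + \<eta>3 * F3)
      + 2 * B1 * (\<beta>2 * F3 - \<beta>3 * F2 + \<eta>1 * F4) + 2 * B2 * (\<beta>3 * F1 - \<beta>1 * F3 + \<eta>2 * F4)
      + 2 * B3 * (\<beta>1 * F2 - \<beta>2 * F1 + \<eta>3 * F4)"
    unfolding F_from_q[symmetric] p_q_F F_combinations D_eq v_q by simp
  also have "\<dots> \<in> ?I"
    by (intro ideal.span_add ideal.span_diff ideal.span_scale) (auto intro: ideal.span_base)
  finally show ?thesis
    using nzd_2 nzdD by blast
qed

text \<open>The link is through \<open>F1\<close>, \<open>F2\<close>, \<open>F3\<close>, with test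
  elements \<open>F4\<close> and \<open>P\<close>. Since k = F - 2 P \<beta> + 2 Q \<alpha>, only
  the products of \<open>F4\<close> and \<open>D\<close> with \<open>P\<close> and \<open>Q\<close>
  need work; those with \<open>D\<close> follow from Cramer's rule.\<close>

lemma linked_pencil_cross:
  "directly_linked (ideal.span {F1, F2, F3, F4, D}) (ideal.span {P, Q, k1, k2, k3})"
proof (rule directly_linkedI)
  let ?L = "{F1, F2, F3}" and ?I = "{P, Q, k1, k2, k3}"
  show "regular_sequence [F1, F2, F3]"
    using gens_aug(1) by (intro regular_sequence3 nzd_mod_F1 nzd_F2 nzd_F3 one_notin_span) auto
  show "?L = set [F1, F2, F3]" by simp
  show "1 \<notin> ideal.span {F1, F2, F3, F4, D}" "1 \<notin> ideal.span ?I"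
    by (intro one_notin_span gens_aug)+
  show "?L \<subseteq> ideal.span {F1, F2, F3, F4, D}"
    by (auto intro: ideal.span_base)
  show sub: "?L \<subseteq> ideal.span ?I"
    unfolding F_defs
    by (auto intro!: ideal.span_add ideal.span_diff ideal.span_scale intro: ideal.span_base)
  have D_PQ:
    "D * P = (\<tau> * \<xi>1 - 2 * \<xi>\<alpha> * \<eta>1) * F1 + (\<tau> * \<xi>2 - 2 * \<xi>\<alpha> * \<eta>2) * F2
      + (\<tau> * \<xi>3 - 2 * \<xi>\<alpha> * \<eta>3) * F3"
    "D * Q = (2 * \<eta>\<beta> * \<xi>1 - (2 * \<xi>\<beta> - \<sigma>) * \<eta>1) * F1 + (2 * \<eta>\<beta> * \<xi>2 - (2 * \<xi>\<beta> - \<sigma>) * \<eta>2) * F2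
      + (2 * \<eta>\<beta> * \<xi>3 - (2 * \<xi>\<beta> - \<sigma>) * \<eta>3) * F3"
  proof -
    have "D * P = \<tau> * (\<xi>1 * F1 + \<xi>2 * F2 + \<xi>3 * F3)
        - 2 * \<xi>\<alpha> * (\<eta>1 * F1 + \<eta>2 * F2 + \<eta>3 * F3)"
      unfolding F_combinations D_eq by (simp add: algebra_simps)
    then show "D * P = (\<tau> * \<xi>1 - 2 * \<xi>\<alpha> * \<eta>1) * F1 + (\<tau> * \<xi>2 - 2 * \<xi>\<alpha> * \<eta>2) * F2
      + (\<tau> * \<xi>3 - 2 * \<xi>\<alpha> * \<eta>3) * F3"
      by (simp add: algebra_simps)
    have "D * Q = 2 * \<eta>\<beta> * (\<xi>1 * F1 + \<xi>2 * F2 + \<xi>3 * F3)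
        - (2 * \<xi>\<beta> - \<sigma>) * (\<eta>1 * F1 + \<eta>2 * F2 + \<eta>3 * F3)"
      unfolding F_combinations D_eq by (simp add: algebra_simps)
    then show "D * Q = (2 * \<eta>\<beta> * \<xi>1 - (2 * \<xi>\<beta> - \<sigma>) * \<eta>1) * F1
      + (2 * \<eta>\<beta> * \<xi>2 - (2 * \<xi>\<beta> - \<sigma>) * \<eta>2) * F2 + (2 * \<eta>\<beta> * \<xi>3 - (2 * \<xi>\<beta> - \<sigma>) * \<eta>3) * F3"
      by (simp add: algebra_simps)
  qed
  have PQ: "F4 * P \<in> ideal.span ?L" "F4 * Q \<in> ideal.span ?L" "D * P \<in> ideal.span ?L"
      "D * Q \<in> ideal.span ?L"
    by (rule F4_P[THEN span_mult_eq] F4_Q[THEN span_mult_eq] D_PQ[THEN span_mult_eq]; simp)+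
  have "a * k1 = a * F1 - 2 * \<beta>1 * (a * P) + 2 * \<alpha>1 * (a * Q)"
    "a * k2 = a * F2 - 2 * \<beta>2 * (a * P) + 2 * \<alpha>2 * (a * Q)"
    "a * k3 = a * F3 - 2 * \<beta>3 * (a * P) + 2 * \<alpha>3 * (a * Q)" for a
    unfolding k1_F k2_F k3_F by (simp_all add: algebra_simps)
  then have "a * k1 \<in> ideal.span ?L" "a * k2 \<in> ideal.span ?L" "a * k3 \<in> ideal.span ?L"
    if "a * P \<in> ideal.span ?L" "a * Q \<in> ideal.span ?L" for a
    using that
    by (auto intro!: ideal.span_add ideal.span_diff ideal.span_scale intro: ideal.span_base)
  then show "a * b \<in> ideal.span ?L" if "a \<in> {F1, F2, F3, F4, D}" "b \<in> ?I" for a b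
    using that PQ by (auto intro: span_mult_left)
  show "r \<in> ideal.span ?I" if "F4 * r \<in> ideal.span ?L" for r
  proof -
    have "F4 * r \<in> ideal.span ?I"
      using that sub by (meson span_subset_iff subsetD)
    \<comment> \<open>A factor \<open>v1\<close> carries the claim to the regular sequence
      \<open>P\<close>, \<open>Q\<close>, \<open>k1\<close>, where \<open>F4\<close> is regular, and
      \<open>cross_colon_v1\<close> carries it back.\<close>
    then have "F4 * (v1 * r) \<in> ideal.span {P, Q, k1}"
      using v1_mult_cross by (metis mult.left_commute)
    moreover have "nzd F4 (ideal.span {P, Q, k1})"
      using nzd_F4 by (simp add: insert_commute)
    ultimately show ?thesis
      using nzdD cross_colon_v1 by blast
  qed
  show "r \<in> ideal.span {F1, F2, F3, F4, D}" if "P * r \<in> ideal.span ?L" for r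
    using that by (rule colon_P)
qed simp_all

theorem licci_pencil: "in_linkage_class_of_ci (ideal.span {F1, F2, F3, F4, D})"
proof -
  have "complete_intersection (ideal.span (set [v1, v2, v3]))"
    unfolding complete_intersection_def using gens_aug(4)
    by (intro exI[of _ "[v1, v2, v3]"] conjI refl regular_sequence3 nzd_v one_notin_span) auto
  moreover have "directly_linked\<^sup>*\<^sup>* (ideal.span {F1, F2, F3, F4, D}) (ideal.span {v1, v2, v3})"
    using linked_pencil_cross linked_cross_determinantal linked_determinantal_vars
    by (meson converse_rtranclp_into_rtranclp rtranclp.rtrancl_refl)
  ultimately show ?thesis
    unfolding in_linkage_class_of_ci_def by auto
qed

end

subsection \<open>Evaluation of polynomials\<close>

lemma poly_mapping_sum_single:
  "(\<Sum>k\<in>Poly_Mapping.keys p. Poly_Mapping.single k (poly_mapping.lookup p k)) = p"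
  by (rule poly_mapping_eqI)
    (auto simp: lookup_sum lookup_single when_def sum.delta' in_keys_iff)

lemma poly_mapping_induct_add [case_names zero single add]:
  fixes P :: "('a \<Rightarrow>\<^sub>0 'b::comm_monoid_add) \<Rightarrow> bool"
  assumes "P 0" "\<And>m c. P (Poly_Mapping.single m c)" "\<And>p q. P p \<Longrightarrow> P q \<Longrightarrow> P (p + q)"
  shows "P p"
proof -
  have "finite M \<Longrightarrow> P (\<Sum>k\<in>M. Poly_Mapping.single k (poly_mapping.lookup p k))" for M
    by (induction M rule: finite_induct) (use assms in auto)
  from this[of "Poly_Mapping.keys p"] show ?thesis
    by (simp add: poly_mapping_sum_single)
qed

text \<open>The universal property of the polynomial ring.\<close>

locale poly_eval =
  fixes \<phi> :: "'k::comm_ring_1 \<Rightarrow> 's::comm_ring_1" and g :: "'v \<Rightarrow> 's"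
  assumes \<phi>_add: "\<phi> (a + b) = \<phi> a + \<phi> b" and \<phi>_mult: "\<phi> (a * b) = \<phi> a * \<phi> b" and \<phi>_1: "\<phi> 1 = 1"
begin

lemma \<phi>_0: "\<phi> 0 = 0"
  using \<phi>_add[of 0 0] by simp

definition monom :: "('v \<Rightarrow>\<^sub>0 nat) \<Rightarrow> 's" where
  "monom m = (\<Prod>v\<in>Poly_Mapping.keys m. g v ^ poly_mapping.lookup m v)"

definition eval :: "(('v \<Rightarrow>\<^sub>0 nat) \<Rightarrow>\<^sub>0 'k) \<Rightarrow> 's" where
  "eval p = (\<Sum>m\<in>Poly_Mapping.keys p. \<phi> (poly_mapping.lookup p m) * monom m)"

lemma monom_superset:
  "finite M \<Longrightarrow> Poly_Mapping.keys m \<subseteq> M \<Longrightarrow> monom m = (\<Prod>v\<in>M. g v ^ poly_mapping.lookup m v)"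
  unfolding monom_def by (rule prod.mono_neutral_left) (auto simp: in_keys_iff)

lemma eval_superset:
  "finite M \<Longrightarrow> Poly_Mapping.keys p \<subseteq> M \<Longrightarrow> eval p = (\<Sum>m\<in>M. \<phi> (poly_mapping.lookup p m) * monom m)"
  unfolding eval_def by (rule sum.mono_neutral_left) (auto simp: in_keys_iff \<phi>_0)

lemma monom_add: "monom (m + n) = monom m * monom n"
proof -
  let ?M = "Poly_Mapping.keys m \<union> Poly_Mapping.keys n"
  have "monom (m + n) = (\<Prod>v\<in>?M. g v ^ poly_mapping.lookup (m + n) v)"
    by (rule monom_superset) (auto dest: keys_add[THEN subsetD])
  then show ?thesis
    by (simp add: monom_superset[of ?M m] monom_superset[of ?M n] lookup_add power_add
        prod.distrib)
qed

lemma eval_0: "eval 0 = 0"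
  by (simp add: eval_def)

lemma eval_add: "eval (p + q) = eval p + eval q"
proof -
  let ?M = "Poly_Mapping.keys p \<union> Poly_Mapping.keys q"
  have "eval (p + q) = (\<Sum>m\<in>?M. \<phi> (poly_mapping.lookup (p + q) m) * monom m)"
    by (rule eval_superset) (auto dest: keys_add[THEN subsetD])
  then show ?thesis
    by (simp add: eval_superset[of ?M p] eval_superset[of ?M q] lookup_add \<phi>_add distrib_right
        sum.distrib)
qed

lemma eval_uminus: "eval (- p) = - eval p"
  using eval_add[of p "- p"] by (simp add: eval_0 eq_neg_iff_add_eq_0 add.commute)

lemma eval_single: "eval (Poly_Mapping.single m c) = \<phi> c * monom m"
  by (simp add: eval_superset[of "{m}"])

lemma eval_1: "eval 1 = 1"
  using eval_single[of 0 1] by (simp add: monom_def \<phi>_1)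

lemma eval_mult: "eval (p * q) = eval p * eval q"
proof (induction p rule: poly_mapping_induct_add)
  case (single m c)
  show ?case
  proof (induction q rule: poly_mapping_induct_add)
    case (single n d)
    then show ?case
      by (simp add: mult_single eval_single monom_add \<phi>_mult mult_ac)
  qed (simp_all add: eval_0 eval_add distrib_left)
qed (simp_all add: eval_0 eval_add distrib_right)

lemma eval_var: "eval (Poly_Mapping.single (Poly_Mapping.single v 1) 1) = g v"
  by (simp add: eval_single monom_def \<phi>_1)

end

lemma single_power_eq_Var:
  "Poly_Mapping.single (Poly_Mapping.single v n) (1::'k::field) = Var v ^ n"
proof (induction n)
  case (Suc n)
  have "Poly_Mapping.single (Poly_Mapping.single v (Suc n)) (1::'k) =
      Var v * Poly_Mapping.single (Poly_Mapping.single v n) 1"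
    by (simp add: Var_def mult_single flip: single_add)
  with Suc show ?case
    by simp
qed simp

text \<open>Used to check on monomials that the shifts become the identity at
  \<open>T = 0\<close>.\<close>

lemma single_eq_prod_Var:
  "Poly_Mapping.single m (c::'k::field) =
    Poly_Mapping.single 0 c * (\<Prod>v\<in>Poly_Mapping.keys m. Var v ^ poly_mapping.lookup m v)"
proof -
  have "finite M \<Longrightarrow> Poly_Mapping.single (\<Sum>v\<in>M. Poly_Mapping.single v (poly_mapping.lookup m v))
      (1::'k) = (\<Prod>v\<in>M. Var v ^ poly_mapping.lookup m v)" for M
  proof (induction M rule: finite_induct)
    case (insert v M)
    have "Poly_Mapping.single (\<Sum>v\<in>insert v M.
          Poly_Mapping.single v (poly_mapping.lookup m v)) (1::'k) =
        Poly_Mapping.single (Poly_Mapping.single v (poly_mapping.lookup m v)) 1 *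
        Poly_Mapping.single (\<Sum>v\<in>M. Poly_Mapping.single v (poly_mapping.lookup m v)) 1"
      using insert.hyps by (simp add: mult_single)
    also have "\<dots> = (\<Prod>v\<in>insert v M. Var v ^ poly_mapping.lookup m v)"
      unfolding insert.IH single_power_eq_Var using insert.hyps by simp
    finally show ?case .
  qed simp
  from this[OF finite_keys[of m]] have e: "Poly_Mapping.single m (1::'k) =
      (\<Prod>v\<in>Poly_Mapping.keys m. Var v ^ poly_mapping.lookup m v)"
    unfolding poly_mapping_sum_single .
  show ?thesis
    unfolding e[symmetric] by (simp add: mult_single)
qed

subsection \<open>The rings \<open>A\<close> and \<open>B\<close>\<close>

text \<open>With these signs \<open>a = - \<xi> \<cdot> \<alpha>\<close>, \<open>b = - (\<xi> \<cdot> \<beta> + \<eta> \<cdot> \<alpha>)\<close> and \<open>c = - \<eta> \<cdot> \<beta>\<close>.\<close>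

definition signed_Var :: "var \<Rightarrow> 'k::field ring_A" where
  "signed_Var v = (if v \<in> {X P14, X P34, Y P14, Y P34} then - Var v else Var v)"

text \<open>Giving the direction the sign of its variable makes the signed variable itself move by
  exactly \<open>e v\<close>.\<close>

definition flip_sign :: "var \<Rightarrow> 'b::comm_ring_1 \<Rightarrow> 'b" where
  "flip_sign v r = (if v \<in> {X P14, X P34, Y P14, Y P34} then - r else r)"

definition shift_A :: "(var \<Rightarrow> 'k::field ring_A) \<Rightarrow> 'k ring_A \<Rightarrow> 'k ring_A poly" where
  "shift_A e = poly_eval.eval (\<lambda>c. [:Poly_Mapping.single 0 c:]) (\<lambda>v. [:Var v, flip_sign v (e v):])"

definition shift_AB :: "(var \<Rightarrow> 'k::field ring_B) \<Rightarrow> 'k ring_A \<Rightarrow> 'k ring_B poly" where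
  "shift_AB e =
    poly_eval.eval (\<lambda>c. [:[:Poly_Mapping.single 0 c:]:]) (\<lambda>v. [:[:Var v:], flip_sign v (e v):])"

text \<open>The coefficients in A are shifted and the result is evaluated at the constant
  \<open>t\<close>, so \<open>t\<close> stays fixed.\<close>

definition shift_B :: "(var \<Rightarrow> 'k::field ring_B) \<Rightarrow> 'k ring_B \<Rightarrow> 'k ring_B poly" where
  "shift_B e p = poly (map_poly (shift_AB e) p) [:Defs.t:]"

text \<open>Its kernel is the ideal \<open>aug\<close> for A; for B the condition is put on the
  constant coefficient.\<close>

definition at_origin :: "'k::field ring_A \<Rightarrow> 'k" where
  "at_origin = poly_eval.eval (\<lambda>c. c) (\<lambda>_. 0)"

interpretation shift_A: poly_eval "\<lambda>c. [:Poly_Mapping.single 0 c:]"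
    "\<lambda>v. [:Var v, flip_sign v (e v):]"
  rewrites "poly_eval.eval (\<lambda>c. [:Poly_Mapping.single 0 c:]) (\<lambda>v. [:Var v, flip_sign v (e v):])
      = shift_A e"
  for e :: "var \<Rightarrow> 'k::field ring_A"
  by unfold_locales (simp_all add: shift_A_def single_add mult_single mult.commute)

interpretation shift_AB: poly_eval "\<lambda>c. [:[:Poly_Mapping.single 0 c:]:]"
    "\<lambda>v. [:[:Var v:], flip_sign v (e v):]"
  rewrites "poly_eval.eval (\<lambda>c. [:[:Poly_Mapping.single 0 c:]:])
      (\<lambda>v. [:[:Var v:], flip_sign v (e v):]) = shift_AB e"
  for e :: "var \<Rightarrow> 'k::field ring_B"
  by unfold_locales (simp_all add: shift_AB_def single_add mult_single mult.commute one_pCons)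

interpretation at_origin: poly_eval "\<lambda>c::'k::field. c" "\<lambda>_::var. 0"
  rewrites "poly_eval.eval (\<lambda>c::'k. c) (\<lambda>_::var. 0) = at_origin"
  by unfold_locales (simp_all add: at_origin_def)

lemma shift_A_at_0: "poly (shift_A e p) 0 = p"
proof (induction p rule: poly_mapping_induct_add)
  case (single m c)
  show ?case
    by (subst (2) single_eq_prod_Var)
      (simp add: shift_A.eval_single shift_A.monom_def poly_prod)
qed (simp_all add: shift_A.eval_0 shift_A.eval_add)

lemma prod_const_poly: "(\<Prod>v\<in>M. [:f v:]) = [:\<Prod>v\<in>M. f v:]"
  by (induction M rule: infinite_finite_induct) (simp_all add: one_pCons mult.commute)

lemma shift_AB_at_0: "poly (shift_AB e p) 0 = [:p:]"
proof (induction p rule: poly_mapping_induct_add)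
  case (single m c)
  have "[:Poly_Mapping.single m c:] = [:Poly_Mapping.single 0 c:] *
      (\<Prod>v\<in>Poly_Mapping.keys m. [:Var v:] ^ poly_mapping.lookup m v)"
    by (subst single_eq_prod_Var) (simp add: poly_const_pow prod_const_poly)
  then show ?case
    by (simp add: shift_AB.eval_single shift_AB.monom_def poly_prod)
qed (simp_all add: shift_AB.eval_0 shift_AB.eval_add)

lemma shift_B_0 [simp]: "shift_B e 0 = 0"
  by (simp add: shift_B_def)

lemma shift_B_pCons [simp]: "shift_B e (pCons a p) = shift_AB e a + [:Defs.t:] * shift_B e p"
  by (simp add: shift_B_def map_poly_pCons shift_AB.eval_0)

lemma shift_B_add: "shift_B e (p + q) = shift_B e p + shift_B e q"
  by (induction p q rule: poly_induct2)
    (simp_all add: shift_AB.eval_add algebra_simps)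

lemma shift_B_smult: "shift_B e (smult a p) = shift_AB e a * shift_B e p"
  by (induction p) (simp_all add: shift_AB.eval_mult algebra_simps)

lemma shift_B_mult: "shift_B e (p * q) = shift_B e p * shift_B e q"
  by (induction p)
    (simp_all add: shift_B_add shift_B_smult shift_AB.eval_0 algebra_simps)

lemma shift_B_at_0: "poly (shift_B e p) 0 = p"
  by (induction p) (simp_all add: shift_AB_at_0 Defs.t_def)

lemma shift_A_signed_Var: "shift_A e (signed_Var v) = [:signed_Var v, e v:]"
  using shift_A.eval_var[of e v]
  by (auto simp: signed_Var_def flip_sign_def Var_def shift_A.eval_uminus)

lemma shift_AB_signed_Var: "shift_AB e (signed_Var v) = [:[:signed_Var v:], e v:]"
  using shift_AB.eval_var[of e v]
  by (auto simp: signed_Var_def flip_sign_def Var_def shift_AB.eval_uminus)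

lemma at_origin_signed_Var: "at_origin (signed_Var v) = 0"
  using at_origin.eval_var[of v]
  by (auto simp: signed_Var_def Var_def at_origin.eval_uminus)

text \<open>Removes the sign by which \<open>F4\<close> differs from the fourth generator.\<close>

lemma span_uminus_4:
  fixes p q r s u :: "'b::comm_ring_1"
  shows "ideal.span {p, q, r, - s, u} = ideal.span {p, q, r, s, u}"
proof -
  have "s \<in> ideal.span {p, q, r, - s, u}"
    using ideal.span_neg[OF ideal.span_base, of "- s" "{p, q, r, - s, u}"] by simp
  moreover have "- s \<in> ideal.span {p, q, r, s, u}"
    using ideal.span_neg[OF ideal.span_base, of s "{p, q, r, s, u}"] by simp
  ultimately show ?thesis
    unfolding ideal.span_eq by (auto intro: ideal.span_base)
qed

lemmas u_defs = signed_Var_def u123_def u124_def u134_def u234_def \<Delta>_def \<delta>1_def \<delta>2_def \<delta>3_def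
  u_poly_def a_poly_def b_poly_def c_poly_def power2_eq_square

lemma two_unit_A:
  assumes "CHAR('k::field) \<noteq> 2"
  obtains h :: "'k::field ring_A" where "h * 2 = 1"
proof -
  have "of_nat 2 \<noteq> (0::'k)"
  proof
    assume "of_nat 2 = (0::'k)"
    then have "CHAR('k) dvd 2"
      by (simp only: of_nat_eq_0_iff_char_dvd)
    then have "CHAR('k) \<le> 2" "CHAR('k) \<noteq> 0"
      by (simp_all add: dvd_imp_le) (metis dvd_0_left_iff zero_neq_numeral gr0I)
    then show False
      using assms CHAR_not_1[where 'a = 'k] by linarith
  qed
  then have "(1 / 2) * (2::'k) = 1"
    by simp
  then have "Poly_Mapping.single 0 (1 / 2 :: 'k) * 2 = (1 :: 'k ring_A)"
    by (metis mult_single single_numeral single_one add_0)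
  then show ?thesis
    by (rule that)
qed

theorem theorem4p1:
  assumes "CHAR('k::field) \<noteq> 2"
  shows "in_linkage_class_of_ci (J :: 'k ring_A set) \<and>
         in_linkage_class_of_ci (J_t :: 'k ring_B set)"
proof
  obtain h :: "'k ring_A" where h: "h * 2 = 1"
    using two_unit_A[OF assms] by blast
  interpret A: pencil "signed_Var :: var \<Rightarrow> 'k ring_A" 0 shift_A "{p. at_origin p = 0}"
    by standard (use h in \<open>auto simp: shift_A.eval_0 shift_A.eval_1 shift_A.eval_add
      shift_A.eval_mult
      at_origin.eval_0 at_origin.eval_1 at_origin.eval_add at_origin.eval_mult shift_A_at_0
      shift_A_signed_Var at_origin_signed_Var ideal.subspace_def simp flip: poly_0_coeff_0\<close>)
  note A_defs = A.F_defs A.D_def A.k1_def A.k2_def A.k3_def A.PQ_defs A.\<sigma>_def A.\<xi>\<alpha>_def A.\<xi>\<beta>_def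
    A.\<eta>\<alpha>_def A.\<eta>\<beta>_def u_defs
  have D: "A.D = u_poly"
    unfolding A_defs by (simp add: algebra_simps)
  have "A.F1 = u234" "A.F2 = u134" "A.F3 = u124" "A.F4 = - u123"
    unfolding A_defs by (simp_all add: algebra_simps)
  with D show "in_linkage_class_of_ci (J :: 'k ring_A set)"
    using A.licci_pencil by (simp add: J_def span_uminus_4)
  have h': "[:h:] * 2 = 1"
    unfolding numeral_poly using h by (simp add: mult.commute one_pCons)
  interpret B: pencil "\<lambda>v. [:signed_Var v :: 'k ring_A:]" Defs.t shift_B
      "{p. at_origin (coeff p 0) = 0}"
  proof
    show "\<exists>h. h * 2 = (1 :: 'k ring_B)"
      using h' by blast
  qed (auto simp: shift_AB.eval_0 shift_AB.eval_1 shift_B_add shift_B_mult at_origin.eval_0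
      at_origin.eval_1 at_origin.eval_add at_origin.eval_mult shift_B_at_0 shift_AB_signed_Var
      at_origin_signed_Var ideal.subspace_def coeff_mult_0 Defs.t_def one_pCons
      simp flip: poly_0_coeff_0)
  note B_defs = B.F_defs B.k1_def B.k2_def B.k3_def B.PQ_defs B.\<sigma>_def B.\<xi>\<alpha>_def B.\<xi>\<beta>_def
    B.\<eta>\<alpha>_def B.\<eta>\<beta>_def
  have "B.F1 = [:u234:] - Defs.t * [:Defs.z T234:]" "B.F2 = [:u134:] - Defs.t * [:Defs.z T134:]"
    "B.F3 = [:u124:] - Defs.t * [:Defs.z T124:]" "B.F4 = - ([:u123:] + Defs.t * [:Defs.z T123:])"
    unfolding B_defs unfolding u_defs Defs.t_def
    by (simp_all add: numeral_poly algebra_simps)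
  \<comment> \<open>The four products are constant in \<open>t\<close>, so \<open>B.D\<close> is
    obtained from \<open>A.D\<close> by restoring the term with \<open>t\<close>.\<close>
  moreover have "B.\<xi>\<alpha> = [:A.\<xi>\<alpha>:]" "B.\<xi>\<beta> = [:A.\<xi>\<beta>:]" "B.\<eta>\<alpha> = [:A.\<eta>\<alpha>:]" "B.\<eta>\<beta> = [:A.\<eta>\<beta>:]"
    unfolding A.\<xi>\<alpha>_def A.\<xi>\<beta>_def A.\<eta>\<alpha>_def A.\<eta>\<beta>_def B.\<xi>\<alpha>_def B.\<xi>\<beta>_def B.\<eta>\<alpha>_def B.\<eta>\<beta>_def
    by (simp_all add: mult.commute)
  then have "B.D = [:u_poly:] - Defs.t\<^sup>2"
    unfolding D[symmetric] A.D_def B.D_def numeral_poly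
    by (simp add: power2_eq_square algebra_simps)
  ultimately show "in_linkage_class_of_ci (J_t :: 'k ring_B set)"
    using B.licci_pencil by (simp only: J_t_def span_uminus_4)
qed

end
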